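(* Let $N,d\ge 1$ and let $V_0,V_1,\dots,V_d\in C_b^\infty(\mathbf{R}^N;\mathbf{R}^N)$ be vector fields on $\mathbf{R}^N$ satisfying the Witt condition, with associated family of vector fields $\{W_n;\,n\ge 0\}$. Then for any $m\ge 1$ and for any sequence $(\xi_1,\xi_2,\dots,\xi_\ell)$ in $\mathcal{L}^*$, there exist a number $k\in\mathbf{N}$ and a sequence $(P_0,P_1,\dots,P_k)$ in $\mathbf{R}[\lambda]^*$ such that $$\Big|E\big[f\big(\exp(\Psi_t(\xi_\ell))\circ\cdots\circ\exp(\Psi_t(\xi_2))\circ\exp(\Psi_t(\xi_1))(x)\big)\big]-E\big[f\big(\exp(\Psi_t(P_kW_k))\circ\cdots\circ\exp(\Psi_t(P_1W_1))\circ\exp(\Psi_t(P_0W_0))(x)\big)\big]\Big|\le C_{f,m,W}\,t^{\frac{m+1}{2}}$$ for any $f\in C_b^\infty(\mathbf{R}^N)$, $t\in(0,1]$ and $x\in\mathbf{R}^N$, where $C_{f,m,W}$ is a constant that depends only on $f$, $m$ and $W=\{W_n;\,n\ge0\}$.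
   Context: $\mathbf{N}=\{1,2,\dots\}$ and $\mathbf{N}_0=\{0,1,2,\dots\}$. $C_b^\infty(\mathbf{R}^N;\mathbf{R}^n)$ is the space of $\mathbf{R}^n$-valued smooth functions on $\mathbf{R}^N$ whose derivatives of any order are bounded; $C_b^\infty(\mathbf{R}^N)=C_b^\infty(\mathbf{R}^N;\mathbf{R})$. A map $V:\mathbf{R}^N\to\mathbf{R}^N$ is regarded as the vector field $(Vf)(x)=\sum_{j=1}^N V^j(x)\,\partial f/\partial x_j(x)$, and $[V,V']=VV'-V'V$. Flow: for a vector field $V$, $\exp(V):\mathbf{R}^N\to\mathbf{R}^N$ is the time-one map $\exp(V)(x)=u(1,x)$, where $\frac{d}{dt}u(t,x)=V(u(t,x))$, $u(0,x)=x$. Witt condition: $\{V_0,\dots,V_d\}$ satisfies the Witt condition if there exists a set of vector fields $\{W_n;n\ge0\}$ such that $V_i\in\mathrm{span}\{W_n;n\ge 0\}$ for $i=0,\dots,d$, and for any $n,m\ge0$, $[W_n,W_m]=\alpha_{nm}W_{n+m}$ with $\alpha_{nm}\in\mathbf{R}$. $L^{\infty,-}$ is the set of random variables having finite moments of all orders. $\mathbf{R}[\lambda]$ is the polynomial ring in $\lambda$. $\mathbf{R}[\lambda]^*=\{\sum_{k=1}^nZ_k\lambda^k;\ n\in\mathbf{N},\ Z_k\in L^{\infty,-}\}$ (random polynomials with no constant term). $\mathcal{L}^*=\{\sum_{k=0}^nQ_kW_k;\ n\in\mathbf{N}_0,\ Q_k\in\mathbf{R}[\lambda]^*\}$. For $t\ge0$,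 $\Psi_t$ is evaluation at $\lambda=\sqrt t$: $\Psi_t(\sum_k a_k\lambda^k)=\sum_k a_k(\sqrt t)^k$, extended naturally to $\mathbf{R}[\lambda]^*$ and to $\mathcal{L}^*$ by $\Psi_t(\sum_kQ_kW_k)=\sum_k\Psi_t(Q_k)W_k$, which is a random vector field.
   Formalization: The constant C may depend on the sequence (ξ_1,…,ξ_ℓ), the chosen P_i and the probability space as well as on f, m and W (a constant uniform over all sequences is impossible), and the vector fields W_n are assumed to lie in C_b^∞(R^N;R^N). *)

theory Defs
  imports "HOL-Probability.Probability" "HOL-Computational_Algebra.Polynomial"
begin

definition partial_deriv :: "'N::finite \<Rightarrow> (real^'N \<Rightarrow> 'b::real_normed_vector) \<Rightarrow> real^'N \<Rightarrow> 'b"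
  where "partial_deriv j f x = frechet_derivative f (at x) (axis j 1)"

definition iter_partial :: "'N::finite list \<Rightarrow> (real^'N \<Rightarrow> 'b::real_normed_vector) \<Rightarrow> real^'N \<Rightarrow> 'b"
  where "iter_partial js f = foldr partial_deriv js f"

text \<open>Every iterated partial derivative is required to be Frechet differentiable (hence
  continuous), so this is the usual \<open>C\<^sup>\<infinity>\<close>.\<close>

definition smooth_functions :: "(real^'N::finite \<Rightarrow> 'b::real_normed_vector) set"
  where "smooth_functions = {f. \<forall>js x. iter_partial js f differentiable (at x)}"

text \<open>The empty multi-index is included: the function itself is bounded as well.\<close>

definition Cb_infinity :: "(real^'N::finite \<Rightarrow> 'b::real_normed_vector) set"
  where "Cb_infinity = {f \<in> smooth_functions. \<forall>js. bounded (range (iter_partial js f))}"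

type_synonym 'N vfield = "real^'N \<Rightarrow> real^'N"

definition vf_op :: "'N::finite vfield \<Rightarrow> (real^'N \<Rightarrow> real) \<Rightarrow> real^'N \<Rightarrow> real"
  where "vf_op V f x = (\<Sum>j\<in>UNIV. V x $ j * partial_deriv j f x)"

definition commutator :: "'N::finite vfield \<Rightarrow> 'N vfield \<Rightarrow> (real^'N \<Rightarrow> real) \<Rightarrow> real^'N \<Rightarrow> real"
  where "commutator V V' f x = vf_op V (vf_op V' f) x - vf_op V' (vf_op V f) x"

text \<open>\<open>W\<close> witnesses the Witt condition for \<open>V 0, \<dots>, V d\<close>. The commutator relation is an
  equality of first-order differential operators on smooth functions.\<close>

definition witt_condition_via :: "(nat \<Rightarrow> 'N::finite vfield) \<Rightarrow> nat \<Rightarrow> (nat \<Rightarrow> 'N vfield) \<Rightarrow> bool"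
  where "witt_condition_via W d V \<longleftrightarrow>
    (\<forall>n. W n \<in> Cb_infinity) \<and>
    (\<forall>i\<le>d. \<exists>n c. V i = (\<lambda>x. \<Sum>k\<le>n. c k *\<^sub>R W k x)) \<and>
    (\<forall>n m. \<exists>\<alpha>::real. \<forall>f\<in>smooth_functions. \<forall>x.
        commutator (W n) (W m) f x = \<alpha> * vf_op (W (n + m)) f x)"

text \<open>The time-one map of the flow. For \<open>V\<close> in \<open>Cb_infinity\<close> the initial value problem has
  exactly one solution on the unit interval, so the description operator is meaningful there.\<close>

definition vf_exp :: "'N::finite vfield \<Rightarrow> real^'N \<Rightarrow> real^'N"
  where "vf_exp V x = (THE y. \<exists>u. u 0 = x \<and> u 1 = y \<and>
    (\<forall>s\<in>{0..1::real}. (u has_vector_derivative V (u s)) (at s within {0..1})))"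

definition L_inf_minus :: "'w measure \<Rightarrow> ('w \<Rightarrow> real) set"
  where "L_inf_minus M =
    {Z \<in> borel_measurable M. \<forall>p::nat. integrable M (\<lambda>\<omega>. \<bar>Z \<omega>\<bar> ^ p)}"

definition Rpoly_star :: "'w measure \<Rightarrow> ('w \<Rightarrow> real poly) set"
  where "Rpoly_star M = {Q. \<exists>n\<ge>1. \<exists>Z. (\<forall>k\<in>{1..n}. Z k \<in> L_inf_minus M) \<and>
    Q = (\<lambda>\<omega>. \<Sum>k=1..n. monom (Z k \<omega>) k)}"

text \<open>Random polynomials in \<open>\<lambda>\<close> with vector field coefficients are represented by the
  associated polynomial functions \<open>\<lambda> \<mapsto> vector field\<close>; over the reals no information is lost.\<close>

type_synonym ('w, 'N) rvf_poly = "'w \<Rightarrow> real \<Rightarrow> 'N vfield"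

definition rvf_term :: "('w \<Rightarrow> real poly) \<Rightarrow> 'N::finite vfield \<Rightarrow> ('w, 'N) rvf_poly"
  where "rvf_term Q W = (\<lambda>\<omega> l x. poly (Q \<omega>) l *\<^sub>R W x)"

definition L_star :: "'w measure \<Rightarrow> (nat \<Rightarrow> 'N::finite vfield) \<Rightarrow> ('w, 'N) rvf_poly set"
  where "L_star M W = {\<xi>. \<exists>n Q. (\<forall>k\<le>n. Q k \<in> Rpoly_star M) \<and>
    \<xi> = (\<lambda>\<omega> l x. \<Sum>k\<le>n. rvf_term (Q k) (W k) \<omega> l x)}"

definition Psi :: "real \<Rightarrow> ('w, 'N::finite) rvf_poly \<Rightarrow> 'w \<Rightarrow> 'N vfield"
  where "Psi t \<xi> \<omega> = \<xi> \<omega> (sqrt t)"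

lemma Psi_rvf_sum:
  "Psi t (\<lambda>\<omega> l x. \<Sum>k\<le>n. rvf_term (Q k) (W k) \<omega> l x) \<omega> x =
    (\<Sum>k\<le>n. poly (Q k \<omega>) (sqrt t) *\<^sub>R W k x)"
  by (simp add: Psi_def rvf_term_def)

text \<open>The head of the list acts first:
  \<open>exp_chain t [\<xi>\<^sub>1, \<dots>, \<xi>\<^sub>l] \<omega> x = (exp (\<Psi>\<^sub>t \<xi>\<^sub>l) \<circ> \<dots> \<circ> exp (\<Psi>\<^sub>t \<xi>\<^sub>1)) x\<close>.\<close>

definition exp_chain :: "real \<Rightarrow> ('w, 'N::finite) rvf_poly list \<Rightarrow> 'w \<Rightarrow> real^'N \<Rightarrow> real^'N"
  where "exp_chain t \<xi>s \<omega> = fold (\<lambda>\<xi>. vf_exp (Psi t \<xi> \<omega>)) \<xi>s"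

end

theory Submission
  imports Defs "HOL-Computational_Algebra.Formal_Power_Series"
begin

text \<open>Taylor's formula along the flow replaces \<open>f \<circ> exp V\<close> by the truncated exponential series of the
  differential operator \<open>V\<close> applied to \<open>f\<close>, so with \<open>\<lambda> = \<surd>t\<close> the claim reduces to an identity modulo
  \<open>\<lambda>\<^sup>m\<^sup>+\<^sup>1\<close> between power series in \<open>\<lambda>\<close> with operator coefficients. Let \<open>U\<close> be the product of the
  exponentials of the given random fields and \<open>\<theta> = \<lambda> d/d\<lambda>\<close>. Then \<open>\<theta>U = AU\<close>, where \<open>A\<close> is a series of
  combinations of the \<open>W\<^sub>n\<close>. The Wei-Norman method peels off one factor at a time: the coefficient of
  \<open>W\<^sub>r\<close> in \<open>A\<close> is integrated to \<open>P\<^sub>r\<close>, and conjugating the rest of \<open>A\<close> by \<open>exp (P\<^sub>r W\<^sub>r)\<close> leaves only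
  \<open>W\<^sub>n\<close> with \<open>n > r\<close>, because \<open>[W\<^sub>r, W\<^sub>n]\<close> is a multiple of \<open>W\<^sub>r\<^sub>+\<^sub>n\<close>. The index \<open>n\<close> occurs in \<open>A\<close> only
  from order \<open>n / q\<close> in \<open>\<lambda>\<close> on, so the procedure stops after \<open>mq + 1\<close> steps, and the equation
  \<open>\<theta>U = AU\<close> with \<open>U(0) = 1\<close> has only one solution modulo \<open>\<lambda>\<^sup>m\<^sup>+\<^sup>1\<close>.\<close>

section \<open>Exponentials of power series over a noncommutative algebra\<close>

text \<open>The coefficients are random, so every estimate is first proved for each \<omega>,
  uniformly in the space variable, with a bound \<open>l ^ Suc m * R \<omega>\<close> where
  \<open>R\<close> has moments of all orders; expectations enter only at the end and give the
  constant as the mean of \<open>R\<close>. For this reason the algebra works with random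
  combinations of fixed operators: finitely many scalar coefficients carry the randomness, and their
  products stay in \<open>L_inf_minus M\<close>. Pulling f back along a flow reverses composition,
  so the map that acts first is the leftmost operator factor, and a list of fields turns into a
  product without reversal. Exponentials are finite sums \<open>texp m\<close>, as the algebra of
  operators carries no topology. The identities for exponentials hold for them up to order m,
  because the k-th power of a series without constant term has order at least k. The derivation
  \<theta> is preferred to d/d\<lambda> because it does not lower orders: no order is lost in a
  congruence, and coefficients are recovered by dividing by i > 0.\<close>

instantiation fps :: (real_vector) real_vector
begin

definition scaleR_fps :: "real \<Rightarrow> 'a fps \<Rightarrow> 'a fps"
  where "scaleR_fps c X = Abs_fps (\<lambda>i. c *\<^sub>R fps_nth X i)"

instance
  by standard (auto simp: scaleR_fps_def fps_eq_iff scaleR_add_left scaleR_add_right)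

end

lemma fps_scaleR_nth [simp]: "fps_nth (c *\<^sub>R X) i = c *\<^sub>R fps_nth X i"
  by (simp add: scaleR_fps_def)

instance fps :: (real_algebra_1) real_algebra_1
  by standard (auto simp: fps_eq_iff fps_mult_nth scaleR_sum_right)

section \<open>Powers, commutators and derivations\<close>

definition ad :: "'a::ring \<Rightarrow> 'a \<Rightarrow> 'a"
  where "ad X Y = X * Y - Y * X"

lemma ad_0_right [simp]: "ad X 0 = 0"
  by (simp add: ad_def)

lemma pascal_sum:
  fixes g :: "nat \<Rightarrow> 'a::real_vector"
  shows "(\<Sum>j\<le>k. real (k choose j) *\<^sub>R g (Suc j)) + (\<Sum>j\<le>k. real (k choose j) *\<^sub>R g j)
    = (\<Sum>j\<le>Suc k. real (Suc k choose j) *\<^sub>R g j)"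
proof -
  have "(\<Sum>j\<le>k. real (k choose j) *\<^sub>R g j) = (\<Sum>j\<le>Suc k. real (k choose j) *\<^sub>R g j)"
    by simp
  also have "\<dots> = g 0 + (\<Sum>j\<le>k. real (k choose Suc j) *\<^sub>R g (Suc j))"
    by (subst sum.atMost_Suc_shift) simp
  finally show ?thesis
    by (subst sum.atMost_Suc_shift) (simp add: scaleR_add_left sum.distrib)
qed

text \<open>Left multiplication by \<open>X\<close> is \<open>ad X\<close> plus right multiplication
  by \<open>X\<close>. These two maps commute, so the formula is the binomial theorem for their sum,
  applied to \<open>Y\<close>.\<close>

lemma power_mult_ad:
  fixes X Y :: "'a::real_algebra_1"
  shows "X ^ k * Y = (\<Sum>j\<le>k. real (k choose j) *\<^sub>R ((ad X ^^ j) Y * X ^ (k - j)))"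
proof (induction k)
  case (Suc k)
  define g where "g j = (ad X ^^ j) Y * X ^ (Suc k - j)" for j
  have step: "X * ((ad X ^^ j) Y * X ^ (k - j)) = g (Suc j) + g j" if "j \<le> k" for j
    using that by (simp add: g_def ad_def Suc_diff_le algebra_simps)
  have "X ^ Suc k * Y = (\<Sum>j\<le>k. real (k choose j) *\<^sub>R (X * ((ad X ^^ j) Y * X ^ (k - j))))"
    by (simp add: mult.assoc Suc.IH sum_distrib_left)
  also have "\<dots> = (\<Sum>j\<le>k. real (k choose j) *\<^sub>R g (Suc j)) + (\<Sum>j\<le>k. real (k choose j) *\<^sub>R g j)"
    by (simp add: step scaleR_add_right sum.distrib)
  also have "\<dots> = (\<Sum>j\<le>Suc k. real (Suc k choose j) *\<^sub>R g j)"
    by (rule pascal_sum)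
  finally show ?case
    by (simp add: g_def)
qed simp

text \<open>The Leibniz rule leaves \<open>D X\<close> between powers of \<open>X\<close>; moving
  the powers on its left to the right with \<open>power_mult_ad\<close> produces the brackets, and
  Pascal's rule collects the coefficients. \<open>D\<close> is later
  \<open>fps_euler\<close>.\<close>

lemma derivation_power:
  fixes X :: "'a::real_algebra_1" and D :: "'a \<Rightarrow> 'a"
  assumes D: "\<And>X Y. D (X * Y) = D X * Y + X * D Y"
  shows "D (X ^ Suc k)
    = (\<Sum>j\<le>k. real (Suc k choose Suc j) *\<^sub>R ((ad X ^^ j) (D X) * X ^ (k - j)))"
proof (induction k)
  case (Suc k)
  define g where "g j = (ad X ^^ j) (D X) * X ^ (Suc k - j)" for j
  have "D (X ^ Suc (Suc k)) = D (X ^ Suc k) * X + X ^ Suc k * D X"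
    using D[of "X ^ Suc k" X] by (simp only: power_Suc2)
  also have "D (X ^ Suc k) * X = (\<Sum>j\<le>k. real (Suc k choose Suc j) *\<^sub>R g j)"
    unfolding Suc.IH sum_distrib_right
    by (intro sum.cong) (auto simp: g_def mult.assoc Suc_diff_le power_commutes)
  also have "\<dots> = (\<Sum>j\<le>Suc k. real (Suc k choose Suc j) *\<^sub>R g j)"
    by (simp add: binomial_eq_0 del: binomial_Suc_Suc)
  also have "X ^ Suc k * D X = (\<Sum>j\<le>Suc k. real (Suc k choose j) *\<^sub>R g j)"
    unfolding g_def by (rule power_mult_ad)
  finally show ?case
    by (simp only: g_def sum.distrib[symmetric] scaleR_add_left[symmetric] of_nat_add[symmetric]
        binomial_Suc_Suc add.commute)
qed simp

section \<open>Congruence modulo a power of the parameter, and the Euler derivation\<close>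

definition fps_agree :: "nat \<Rightarrow> 'a::zero fps \<Rightarrow> 'a fps \<Rightarrow> bool"
  where "fps_agree m X Y \<longleftrightarrow> (\<forall>i\<le>m. fps_nth X i = fps_nth Y i)"

lemma fps_agree_refl [simp]: "fps_agree m X X"
  by (simp add: fps_agree_def)

lemma fps_agree_sym: "fps_agree m X Y \<Longrightarrow> fps_agree m Y X"
  by (simp add: fps_agree_def)

lemma fps_agree_trans [trans]: "fps_agree m X Y \<Longrightarrow> fps_agree m Y Z \<Longrightarrow> fps_agree m X Z"
  by (simp add: fps_agree_def)

lemma fps_agree_eq_trans [trans]:
  "fps_agree m X Y \<Longrightarrow> Y = Z \<Longrightarrow> fps_agree m X Z"
  "X = Y \<Longrightarrow> fps_agree m Y Z \<Longrightarrow> fps_agree m X Z"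
  by auto

lemma fps_agree_add: "fps_agree m X Y \<Longrightarrow> fps_agree m X' Y' \<Longrightarrow> fps_agree m (X + X') (Y + Y')"
  by (simp add: fps_agree_def)

lemma fps_agree_mult:
  fixes X Y :: "'a::semiring_0 fps"
  shows "fps_agree m X Y \<Longrightarrow> fps_agree m X' Y' \<Longrightarrow> fps_agree m (X * X') (Y * Y')"
  by (auto simp: fps_agree_def fps_mult_nth intro!: sum.cong)

definition fps_euler :: "'a::real_vector fps \<Rightarrow> 'a fps"
  where "fps_euler X = Abs_fps (\<lambda>i. real i *\<^sub>R fps_nth X i)"

lemma fps_euler_nth [simp]: "fps_nth (fps_euler X) i = real i *\<^sub>R fps_nth X i"
  by (simp add: fps_euler_def)

lemma fps_euler_mult:
  fixes X Y :: "'a::real_algebra_1 fps"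
  shows "fps_euler (X * Y) = fps_euler X * Y + X * fps_euler Y"
proof (rule fps_ext)
  fix i
  have "real i *\<^sub>R (fps_nth X j * fps_nth Y (i - j))
      = real j *\<^sub>R fps_nth X j * fps_nth Y (i - j)
        + fps_nth X j * real (i - j) *\<^sub>R fps_nth Y (i - j)" if "j \<le> i" for j
    using that by (simp add: of_nat_diff scaleR_diff_left right_diff_distrib)
  then show "fps_nth (fps_euler (X * Y)) i = fps_nth (fps_euler X * Y + X * fps_euler Y) i"
    by (simp add: fps_mult_nth scaleR_sum_right sum.distrib[symmetric])
qed

lemma fps_euler_1 [simp]: "fps_euler (1 :: 'a::real_algebra_1 fps) = 0"
  by (simp add: fps_eq_iff)

lemma fps_euler_add: "fps_euler (X + Y) = fps_euler X + fps_euler Y"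
  by (simp add: fps_eq_iff scaleR_add_right)

lemma fps_euler_scaleR: "fps_euler (c *\<^sub>R X) = c *\<^sub>R fps_euler X"
  by (simp add: fps_eq_iff)

lemma fps_euler_sum: "fps_euler (\<Sum>a\<in>A. F a) = (\<Sum>a\<in>A. fps_euler (F a))"
  by (simp add: fps_eq_iff fps_sum_nth scaleR_sum_right)

text \<open>Since \<open>A\<close> has no constant term, the coefficient of \<open>A * U\<close> at
  order i involves only coefficients of \<open>U\<close> below i, while the left side is i times the
  coefficient at i. The equation is thus a recursion that determines everything up to order m from
  the constant term.\<close>

lemma fps_euler_eq_unique:
  fixes U V :: "'a::real_algebra_1 fps"
  assumes U: "fps_agree m (fps_euler U) (A * U)" and V: "fps_agree m (fps_euler V) (A * V)"
    and 0: "fps_nth U 0 = fps_nth V 0" and A: "fps_nth A 0 = 0"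
  shows "fps_agree m U V"
proof -
  have "i \<le> m \<Longrightarrow> fps_nth U i = fps_nth V i" for i
  proof (induction i rule: less_induct)
    case (less i)
    show ?case
    proof (cases "i = 0")
      case False
      have "fps_nth (A * U) i = fps_nth (A * V) i"
        unfolding fps_mult_nth
      proof (rule sum.cong[OF refl])
        fix j assume "j \<in> {0..i}"
        then show "fps_nth A j * fps_nth U (i - j) = fps_nth A j * fps_nth V (i - j)"
          using less A by (cases "j = 0") auto
      qed
      then have "real i *\<^sub>R fps_nth U i = real i *\<^sub>R fps_nth V i"
        using U V less.prems by (simp add: fps_agree_def)
      with False show ?thesis by simp
    qed (use 0 in simp)
  qed
  then show ?thesis by (simp add: fps_agree_def)
qed

lemma fps_mult_nth_eq_0:
  fixes X Y :: "'a::semiring_0 fps"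
  assumes "\<And>i. i < j \<Longrightarrow> fps_nth X i = 0" "\<And>i. i < l \<Longrightarrow> fps_nth Y i = 0" "i < j + l"
  shows "fps_nth (X * Y) i = 0"
  unfolding fps_mult_nth
proof (rule sum.neutral, rule ballI)
  fix p assume "p \<in> {0..i}"
  then have "p < j \<or> i - p < l" using assms(3) by auto
  then show "fps_nth X p * fps_nth Y (i - p) = 0" using assms by auto
qed

lemma fps_power_nth_eq_0:
  fixes X :: "'a::semiring_1 fps"
  assumes "fps_nth X 0 = 0"
  shows "i < k \<Longrightarrow> fps_nth (X ^ k) i = 0"
proof (induction k arbitrary: i)
  case (Suc k)
  show ?case unfolding power_Suc
    by (rule fps_mult_nth_eq_0[of 1 _ k]) (use Suc assms in auto)
qed simp

lemma fps_ad_power_nth_eq_0: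
  fixes X :: "'a::ring_1 fps"
  assumes "fps_nth X 0 = 0" "\<And>i. i < l \<Longrightarrow> fps_nth Y i = 0"
  shows "i < k + l \<Longrightarrow> fps_nth ((ad X ^^ k) Y) i = 0"
proof (induction k arbitrary: i)
  case (Suc k)
  have "fps_nth (X * (ad X ^^ k) Y) i = 0"
    by (rule fps_mult_nth_eq_0[of 1 _ "k + l"]) (use Suc assms in auto)
  moreover have "fps_nth ((ad X ^^ k) Y * X) i = 0"
    by (rule fps_mult_nth_eq_0[of "k + l" _ 1]) (use Suc assms in auto)
  ultimately show ?case by (simp add: ad_def[of X "(ad X ^^ k) Y"])
qed (use assms in simp)

text \<open>The terms of the square with j + l > m have order above m, so only the triangle is seen.
  Truncated series can therefore be multiplied by the rule for full exponential series.\<close>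

lemma fps_agree_sum_mult_sum:
  fixes a b :: "nat \<Rightarrow> 'a::semiring_0 fps"
  assumes a: "\<And>i j. i < j \<Longrightarrow> fps_nth (a j) i = 0" and b: "\<And>i l. i < l \<Longrightarrow> fps_nth (b l) i = 0"
  shows "fps_agree m ((\<Sum>j\<le>m. a j) * (\<Sum>l\<le>m. b l)) (\<Sum>k\<le>m. \<Sum>j\<le>k. a j * b (k - j))"
  unfolding fps_agree_def
proof (intro allI impI)
  fix i assume "i \<le> m"
  have "fps_nth ((\<Sum>j\<le>m. a j) * (\<Sum>l\<le>m. b l)) i
      = (\<Sum>(j,l)\<in>{..m} \<times> {..m}. fps_nth (a j * b l) i)"
    by (simp add: sum_product fps_sum_nth sum.cartesian_product case_prod_unfold)
  also have "\<dots> = (\<Sum>(j,l)\<in>{(j,l). j + l \<le> m}. fps_nth (a j * b l) i)"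
  proof (rule sum.mono_neutral_right)
    show "\<forall>p\<in>{..m} \<times> {..m} - {(j, l). j + l \<le> m}. (case p of (j, l) \<Rightarrow> fps_nth (a j * b l) i) = 0"
      using \<open>i \<le> m\<close> by (auto intro!: fps_mult_nth_eq_0 a b)
  qed auto
  also have "\<dots> = fps_nth (\<Sum>k\<le>m. \<Sum>j\<le>k. a j * b (k - j)) i"
    by (simp add: sum.triangle_reindex_eq fps_sum_nth)
  finally show "fps_nth ((\<Sum>j\<le>m. a j) * (\<Sum>l\<le>m. b l)) i
    = fps_nth (\<Sum>k\<le>m. \<Sum>j\<le>k. a j * b (k - j)) i" .
qed

section \<open>Truncated exponentials\<close>

definition texp :: "nat \<Rightarrow> 'a::real_algebra_1 \<Rightarrow> 'a"
  where "texp m X = (\<Sum>k\<le>m. (1 / fact k) *\<^sub>R X ^ k)"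

definition texp_ad :: "nat \<Rightarrow> 'a::real_algebra_1 \<Rightarrow> 'a \<Rightarrow> 'a"
  where "texp_ad m X Y = (\<Sum>j\<le>m. (1 / fact j) *\<^sub>R (ad X ^^ j) Y)"

text \<open>The truncation of \<open>(e\<^sup>z - 1) / z\<close> at \<open>z = ad X\<close>, which maps a derivative of \<open>X\<close> to the
  logarithmic derivative of \<open>exp X\<close>.\<close>

definition tdexp :: "nat \<Rightarrow> 'a::real_algebra_1 \<Rightarrow> 'a \<Rightarrow> 'a"
  where "tdexp m X Y = (\<Sum>j\<le>m. (1 / fact (Suc j)) *\<^sub>R (ad X ^^ j) Y)"

lemma binomial_div_fact: "j \<le> k \<Longrightarrow> real (k choose j) / fact k = 1 / (fact j * fact (k - j))"
  by (simp add: binomial_fact)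

text \<open>Hadamard's lemma exp(X) Y exp(-X) = exp(ad X) Y with the inverse moved to the other
  side: \<open>power_mult_ad\<close> divided by k! is a term of the Cauchy product of the series in
  \<open>ad X\<close> and in \<open>X\<close>.\<close>

lemma texp_conjugate:
  fixes X Y :: "'a::real_algebra_1 fps"
  assumes "fps_nth X 0 = 0"
  shows "fps_agree m (texp m X * Y) (texp_ad m X Y * texp m X)"
proof -
  have "texp m X * Y = (\<Sum>k\<le>m. (1 / fact k) *\<^sub>R (X ^ k * Y))"
    by (simp add: texp_def sum_distrib_right)
  also have "\<dots> = (\<Sum>k\<le>m. \<Sum>j\<le>k. ((1 / fact j) *\<^sub>R (ad X ^^ j) Y) * ((1 / fact (k - j)) *\<^sub>R X ^ (k - j)))"
    by (intro sum.cong)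
      (auto simp: power_mult_ad scaleR_sum_right binomial_div_fact mult.commute intro!: sum.cong)
  also have "fps_agree m \<dots> (texp_ad m X Y * texp m X)"
    unfolding texp_def texp_ad_def
    by (intro fps_agree_sym[OF fps_agree_sum_mult_sum])
      (use assms in \<open>auto simp: fps_power_nth_eq_0 intro!: fps_ad_power_nth_eq_0[of _ 0]\<close>)
  finally show ?thesis .
qed

text \<open>The formula for the derivative of an exponential whose exponent need not commute with
  its own derivative: \<open>derivation_power\<close> divided by (k + 1)! is a term of the Cauchy
  product of the two series on the right.\<close>

lemma texp_euler:
  fixes X :: "'a::real_algebra_1 fps"
  assumes "fps_nth X 0 = 0"
  shows "fps_agree m (fps_euler (texp m X)) (tdexp m X (fps_euler X) * texp m X)"
proof -
  let ?a = "\<lambda>j. (1 / fact (Suc j)) *\<^sub>R (ad X ^^ j) (fps_euler X)"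
  let ?b = "\<lambda>l. (1 / fact l) *\<^sub>R X ^ l"
  have ad0: "fps_nth ((ad X ^^ j) (fps_euler X)) i = 0" if "i < j + 1" for i j
    using that by (intro fps_ad_power_nth_eq_0[of _ 1]) (use assms in auto)
  have term_eq: "(1 / fact (Suc k)) *\<^sub>R fps_euler (X ^ Suc k) = (\<Sum>j\<le>k. ?a j * ?b (k - j))" for k
    unfolding derivation_power[of fps_euler, OF fps_euler_mult] scaleR_sum_right
  proof (rule sum.cong[OF refl])
    fix j assume "j \<in> {..k}"
    then show "(1 / fact (Suc k)) *\<^sub>R real (Suc k choose Suc j) *\<^sub>R
         ((ad X ^^ j) (fps_euler X) * X ^ (k - j)) = ?a j * ?b (k - j)"
      using binomial_div_fact[of "Suc j" "Suc k"] by (simp del: fact_Suc binomial_Suc_Suc)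
  qed
  have "fps_euler (texp m X) = (\<Sum>k<m. (1 / fact (Suc k)) *\<^sub>R fps_euler (X ^ Suc k))"
    unfolding texp_def lessThan_Suc_atMost[symmetric] sum.lessThan_Suc_shift
    by (simp add: fps_euler_add fps_euler_sum fps_euler_scaleR del: power_Suc fact_Suc)
  also have "\<dots> = (\<Sum>k<m. \<Sum>j\<le>k. ?a j * ?b (k - j))"
    by (simp only: term_eq)
  also have "fps_agree m \<dots> (\<Sum>k\<le>m. \<Sum>j\<le>k. ?a j * ?b (k - j))"
  proof -
    \<comment> \<open>The sum obtained so far stops at k < m, since \<theta> kills the term of
      degree 0. The missing terms k = m have order at least (j + 1) + (m - j) = m + 1, where the
      extra 1 comes from \<theta>X having no constant term.\<close>
    have "fps_nth (?a j * ?b (m - j)) i = 0" if "j \<le> m" "i \<le> m" for i j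
      using that by (intro fps_mult_nth_eq_0[of "j + 1" _ "m - j"])
        (auto simp: ad0 fps_power_nth_eq_0 assms)
    then have "fps_agree m 0 (\<Sum>j\<le>m. ?a j * ?b (m - j))"
      by (simp add: fps_agree_def fps_sum_nth)
    then show ?thesis
      by (simp add: lessThan_Suc_atMost[symmetric] fps_agree_def)
  qed
  also have "fps_agree m \<dots> (tdexp m X (fps_euler X) * texp m X)"
    unfolding texp_def tdexp_def
    by (intro fps_agree_sym[OF fps_agree_sum_mult_sum]) (use assms in \<open>auto simp: fps_power_nth_eq_0 ad0\<close>)
  finally show ?thesis .
qed

text \<open>The coefficient of X^k in the Cauchy product is (1 - 1)^k / k!, an alternating sum of
  binomial coefficients.\<close>

lemma texp_mult_texp_minus:
  fixes X :: "'a::real_algebra_1 fps"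
  assumes "fps_nth X 0 = 0"
  shows "fps_agree m (texp m X * texp m (- X)) 1"
proof -
  let ?a = "\<lambda>j. (1 / fact j) *\<^sub>R X ^ j" and ?b = "\<lambda>l. (1 / fact l) *\<^sub>R (- X) ^ l"
  have "fps_agree m (texp m X * texp m (- X)) (\<Sum>k\<le>m. \<Sum>j\<le>k. ?a j * ?b (k - j))"
    unfolding texp_def by (intro fps_agree_sum_mult_sum) (use assms in \<open>auto simp: fps_power_nth_eq_0\<close>)
  also have "(\<Sum>k\<le>m. \<Sum>j\<le>k. ?a j * ?b (k - j)) = (\<Sum>k\<le>m. if k = 0 then 1 else 0)"
  proof (rule sum.cong[OF refl])
    fix k
    have "?a j * ?b (k - j) = (((- 1) ^ k / fact k) * ((- 1) ^ j * real (k choose j))) *\<^sub>R X ^ k"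
      if "j \<le> k" for j
    proof -
      have "(- X) ^ (k - j) = ((- 1) ^ (k - j)) *\<^sub>R X ^ (k - j)"
        by (metis power_minus scaleR_conv_of_real of_real_minus of_real_1 of_real_power)
      moreover have "(- 1 :: real) ^ (k - j) = (- 1) ^ k * (- 1) ^ j"
        using that by (simp add: power_add[symmetric] uminus_power_if)
      moreover have "X ^ j * X ^ (k - j) = X ^ k"
        using that by (simp add: power_add[symmetric])
      ultimately show ?thesis
        using binomial_div_fact[OF that] that by (simp add: field_simps)
    qed
    then have "(\<Sum>j\<le>k. ?a j * ?b (k - j))
      = (\<Sum>j\<le>k. (((- 1) ^ k / fact k) * ((- 1) ^ j * real (k choose j))) *\<^sub>R X ^ k)"
      by simp
    also have "\<dots> = (((- 1) ^ k / fact k) * (\<Sum>j\<le>k. (- 1) ^ j * real (k choose j))) *\<^sub>R X ^ k"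
      by (simp only: scaleR_sum_left[symmetric] sum_distrib_left)
    also have "\<dots> = (if k = 0 then 1 else 0)"
      using choose_alternating_sum[of k, where 'a = real] by (cases "k = 0") auto
    finally show "(\<Sum>j\<le>k. ?a j * ?b (k - j)) = (if k = 0 then 1 else 0)" .
  qed
  also have "\<dots> = (1 :: 'a fps)"
    by simp
  finally show ?thesis .
qed

text \<open>Used to peel a factor E = \<open>texp m X\<close> off the left: Y E R becomes E (exp(-ad
  X) Y) R, so the remaining product R has to satisfy an equation with exp(-ad X) Y. The truncated
  inverse is inserted because \<open>texp_conjugate\<close> for -X only moves Y past
  \<open>texp m (- X)\<close>.\<close>

lemma texp_conjugate_minus:
  fixes X Y :: "'a::real_algebra_1 fps"
  assumes "fps_nth X 0 = 0"
  shows "fps_agree m (texp m X * texp_ad m (- X) Y) (Y * texp m X)"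
proof -
  let ?E = "texp m X" and ?F = "texp m (- X)" and ?Y = "texp_ad m (- X) Y"
  have FE: "fps_agree m (?F * ?E) 1"
    using texp_mult_texp_minus[of "- X" m] assms by simp
  have "fps_agree m (?E * ?Y) (?E * (?Y * (?F * ?E)))"
    using fps_agree_mult[OF fps_agree_refl fps_agree_mult[OF fps_agree_refl FE], of ?E ?Y]
    by (simp add: fps_agree_sym)
  also have "\<dots> = ?E * (?Y * ?F) * ?E"
    by (simp add: mult.assoc)
  also have "fps_agree m \<dots> (?E * (?F * Y) * ?E)"
    using texp_conjugate[of "- X" m Y] assms
    by (intro fps_agree_mult[OF fps_agree_mult[OF fps_agree_refl fps_agree_sym] fps_agree_refl]) simp
  also have "\<dots> = (?E * ?F) * (Y * ?E)"
    by (simp add: mult.assoc)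
  also have "fps_agree m \<dots> (1 * (Y * ?E))"
    by (intro fps_agree_mult fps_agree_refl texp_mult_texp_minus assms)
  finally show ?thesis by simp
qed

section \<open>Random linear combinations\<close>

context prob_space
begin

lemma L_inf_minusI:
  assumes "Z \<in> borel_measurable M" "\<And>p. integrable M (\<lambda>\<omega>. g p \<omega> :: real)"
    "\<And>p \<omega>. \<bar>Z \<omega>\<bar> ^ p \<le> g p \<omega>"
  shows "Z \<in> L_inf_minus M"
  unfolding L_inf_minus_def
proof (intro CollectI conjI allI)
  fix p :: nat
  have "\<bar>\<bar>Z \<omega>\<bar> ^ p\<bar> \<le> \<bar>g p \<omega>\<bar>" for \<omega>
    using assms(3)[of \<omega> p] by (simp add: abs_le_iff)
  then show "integrable M (\<lambda>\<omega>. \<bar>Z \<omega>\<bar> ^ p)"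
    using assms(1) by (intro Bochner_Integration.integrable_bound[OF assms(2)[of p]]) auto
qed (use assms in simp)

lemma L_inf_minus_const: "(\<lambda>_. c) \<in> L_inf_minus M"
  by (simp add: L_inf_minus_def)

lemma L_inf_minus_add:
  assumes "Z \<in> L_inf_minus M" "Y \<in> L_inf_minus M"
  shows "(\<lambda>\<omega>. Z \<omega> + Y \<omega>) \<in> L_inf_minus M"
proof (rule L_inf_minusI[where g = "\<lambda>p \<omega>. 2 ^ p * (\<bar>Z \<omega>\<bar> ^ p + \<bar>Y \<omega>\<bar> ^ p)"])
  fix p \<omega>
  have "\<bar>Z \<omega> + Y \<omega>\<bar> ^ p \<le> (2 * max \<bar>Z \<omega>\<bar> \<bar>Y \<omega>\<bar>) ^ p"
    by (intro power_mono) auto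
  also have "\<dots> \<le> 2 ^ p * (\<bar>Z \<omega>\<bar> ^ p + \<bar>Y \<omega>\<bar> ^ p)"
    unfolding power_mult_distrib by (intro mult_left_mono) (auto simp: max_def)
  finally show "\<bar>Z \<omega> + Y \<omega>\<bar> ^ p \<le> 2 ^ p * (\<bar>Z \<omega>\<bar> ^ p + \<bar>Y \<omega>\<bar> ^ p)" .
qed (use assms in \<open>auto simp: L_inf_minus_def\<close>)

text \<open>Pointwise a b <= a^2 + b^2: moment p of the product is controlled by the moments 2p of
  the factors, which is where finiteness of all moments enters.\<close>

lemma L_inf_minus_mult:
  assumes "Z \<in> L_inf_minus M" "Y \<in> L_inf_minus M"
  shows "(\<lambda>\<omega>. Z \<omega> * Y \<omega>) \<in> L_inf_minus M"
proof (rule L_inf_minusI[where g = "\<lambda>p \<omega>. \<bar>Z \<omega>\<bar> ^ (2 * p) + \<bar>Y \<omega>\<bar> ^ (2 * p)"])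
  fix p \<omega>
  have "2 * (\<bar>Z \<omega>\<bar> ^ p * \<bar>Y \<omega>\<bar> ^ p) \<le> (\<bar>Z \<omega>\<bar> ^ p)\<^sup>2 + (\<bar>Y \<omega>\<bar> ^ p)\<^sup>2"
    using sum_squares_bound[of "\<bar>Z \<omega>\<bar> ^ p" "\<bar>Y \<omega>\<bar> ^ p"] by (simp add: mult.assoc)
  moreover have "0 \<le> \<bar>Z \<omega>\<bar> ^ p * \<bar>Y \<omega>\<bar> ^ p"
    by simp
  ultimately have "\<bar>Z \<omega>\<bar> ^ p * \<bar>Y \<omega>\<bar> ^ p \<le> (\<bar>Z \<omega>\<bar> ^ p)\<^sup>2 + (\<bar>Y \<omega>\<bar> ^ p)\<^sup>2"
    by linarith
  then show "\<bar>Z \<omega> * Y \<omega>\<bar> ^ p \<le> \<bar>Z \<omega>\<bar> ^ (2 * p) + \<bar>Y \<omega>\<bar> ^ (2 * p)"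
    by (simp add: abs_mult power_mult_distrib power_mult[symmetric] mult.commute)
qed (use assms in \<open>auto simp: L_inf_minus_def\<close>)

lemma L_inf_minus_cmult: "Z \<in> L_inf_minus M \<Longrightarrow> (\<lambda>\<omega>. c * Z \<omega>) \<in> L_inf_minus M"
  by (rule L_inf_minus_mult[OF L_inf_minus_const])

lemma L_inf_minus_abs: "Z \<in> L_inf_minus M \<Longrightarrow> (\<lambda>\<omega>. \<bar>Z \<omega>\<bar>) \<in> L_inf_minus M"
  by (auto simp: L_inf_minus_def)

lemma L_inf_minus_sum:
  "(\<And>a. a \<in> A \<Longrightarrow> Z a \<in> L_inf_minus M) \<Longrightarrow> (\<lambda>\<omega>. \<Sum>a\<in>A. Z a \<omega>) \<in> L_inf_minus M"
  by (induction A rule: infinite_finite_induct) (auto simp: L_inf_minus_const L_inf_minus_add)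

lemma L_inf_minus_integrable: "Z \<in> L_inf_minus M \<Longrightarrow> integrable M Z"
  unfolding L_inf_minus_def
  by (auto dest!: spec[of _ "1::nat"] simp: integrable_abs_iff)

lemma Rpoly_starI:
  "n \<ge> 1 \<Longrightarrow> (\<And>k. Z k \<in> L_inf_minus M) \<Longrightarrow> (\<lambda>\<omega>. \<Sum>k=1..n. monom (Z k \<omega>) k) \<in> Rpoly_star M"
  unfolding Rpoly_star_def mem_Collect_eq
  by (rule exI[of _ n], rule conjI, assumption, rule exI[of _ Z]) simp

lemma Rpoly_star_coeff:
  assumes "Q \<in> Rpoly_star M"
  obtains n where "n \<ge> 1" "\<And>i. (\<lambda>\<omega>. coeff (Q \<omega>) i) \<in> L_inf_minus M"
    "\<And>\<omega> i. i = 0 \<or> i > n \<Longrightarrow> coeff (Q \<omega>) i = 0"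
proof -
  obtain n Z where n: "n \<ge> 1" and Z: "\<And>k. k \<in> {1..n} \<Longrightarrow> Z k \<in> L_inf_minus M"
    and Q: "Q = (\<lambda>\<omega>. \<Sum>k=1..n. monom (Z k \<omega>) k)"
    using assms unfolding Rpoly_star_def mem_Collect_eq by (elim exE conjE) metis
  have coeff_Q: "coeff (Q \<omega>) i = (if i \<in> {1..n} then Z i \<omega> else 0)" for \<omega> i
    by (simp add: Q coeff_sum)
  show ?thesis
  proof (rule that[OF n])
    show "(\<lambda>\<omega>. coeff (Q \<omega>) i) \<in> L_inf_minus M" for i
      unfolding coeff_Q by (cases "i \<in> {1..n}") (simp_all add: Z L_inf_minus_const del: atLeastAtMost_iff)
  qed (auto simp: coeff_Q)
qed

lemma Rpoly_star_0: "(\<lambda>_. 0) \<in> Rpoly_star M"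
  using Rpoly_starI[of 1 "\<lambda>_ _. 0"] by (simp add: L_inf_minus_const)

end

text \<open>Random elements of a span, with finitely many fixed generators and all randomness in the
  scalars. The inductive form does without a basis, as the generators may be linearly dependent, and
  without a measurable structure on the vector space.\<close>

inductive_set rspan :: "'w measure \<Rightarrow> 'a::real_vector set \<Rightarrow> ('w \<Rightarrow> 'a) set"
  for M :: "'w measure" and B :: "'a set"
where
  rspan_zero: "(\<lambda>_. 0) \<in> rspan M B"
| rspan_base: "Z \<in> L_inf_minus M \<Longrightarrow> b \<in> B \<Longrightarrow> (\<lambda>\<omega>. Z \<omega> *\<^sub>R b) \<in> rspan M B"
| rspan_add: "S \<in> rspan M B \<Longrightarrow> T \<in> rspan M B \<Longrightarrow> (\<lambda>\<omega>. S \<omega> + T \<omega>) \<in> rspan M B"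

lemma rspan_mono: "T \<in> rspan M B \<Longrightarrow> B \<subseteq> C \<Longrightarrow> T \<in> rspan M C"
  by (induction rule: rspan.induct) (auto intro: rspan.intros)

lemma rspan_sum:
  "(\<And>a. a \<in> A \<Longrightarrow> T a \<in> rspan M B) \<Longrightarrow> (\<lambda>\<omega>. \<Sum>a\<in>A. T a \<omega>) \<in> rspan M B"
  by (induction A rule: infinite_finite_induct) (auto intro: rspan.intros)

lemma rspan_empty: "T \<in> rspan M {} \<Longrightarrow> T = (\<lambda>_. 0)"
  by (induction rule: rspan.induct) auto

context prob_space
begin

lemma rspan_scaleR:
  assumes Z: "Z \<in> L_inf_minus M" and "T \<in> rspan M B"
  shows "(\<lambda>\<omega>. Z \<omega> *\<^sub>R T \<omega>) \<in> rspan M B"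
  using assms(2)
proof induction
  case (rspan_base Y b)
  have "(\<lambda>\<omega>. (Z \<omega> * Y \<omega>) *\<^sub>R b) \<in> rspan M B"
    by (intro rspan.rspan_base L_inf_minus_mult Z rspan_base)
  then show ?case by simp
qed (auto simp: scaleR_add_right intro: rspan.intros)

lemma rspan_cscaleR: "T \<in> rspan M B \<Longrightarrow> (\<lambda>\<omega>. c *\<^sub>R T \<omega>) \<in> rspan M B"
  by (rule rspan_scaleR[OF L_inf_minus_const])

lemma rspan_minus: "T \<in> rspan M B \<Longrightarrow> (\<lambda>\<omega>. - T \<omega>) \<in> rspan M B"
  using rspan_cscaleR[of T B "-1"] by simp

lemma rspan_const: "b \<in> B \<Longrightarrow> (\<lambda>_. b) \<in> rspan M B"
  using rspan_base[OF L_inf_minus_const[of 1]] by simp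

lemma rspan_bilinear:
  assumes f: "bilinear f" and S: "S \<in> rspan M B" and T: "T \<in> rspan M C"
    and D: "\<And>b c. b \<in> B \<Longrightarrow> c \<in> C \<Longrightarrow> (\<lambda>_. f b c) \<in> rspan M D"
  shows "(\<lambda>\<omega>. f (S \<omega>) (T \<omega>)) \<in> rspan M D"
  using S
proof induction
  case (rspan_base Z b)
  have "(\<lambda>\<omega>. f b (T \<omega>)) \<in> rspan M D"
    using T
  proof induction
    case (rspan_base Y c)
    then show ?case
      using rspan_scaleR[OF rspan_base(1) D[OF \<open>b \<in> B\<close> rspan_base(2)]] by (simp add: bilinear_rmul[OF f])
  qed (auto simp: bilinear_rzero[OF f] bilinear_radd[OF f] intro: rspan.intros)
  then show ?case
    using rspan_scaleR[OF rspan_base(1)] by (simp add: bilinear_lmul[OF f])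
qed (auto simp: bilinear_lzero[OF f] bilinear_ladd[OF f] intro: rspan.intros)

text \<open>The coefficient of \<open>b\<close> is not unique if the generators are dependent; the
  Wei-Norman step works with any choice of it.\<close>

lemma rspan_insert:
  assumes "T \<in> rspan M (insert b B)"
  obtains Z S where "Z \<in> L_inf_minus M" "S \<in> rspan M B" "\<And>\<omega>. T \<omega> = Z \<omega> *\<^sub>R b + S \<omega>"
proof -
  have "\<exists>Z\<in>L_inf_minus M. \<exists>S\<in>rspan M B. \<forall>\<omega>. T \<omega> = Z \<omega> *\<^sub>R b + S \<omega>"
    using assms
  proof induction
    case rspan_zero
    show ?case
      by (rule bexI[of _ "\<lambda>_. 0"], rule bexI[of _ "\<lambda>_. 0"])
        (auto intro: rspan.rspan_zero L_inf_minus_const)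
  next
    case (rspan_base Y c)
    show ?case
    proof (cases "c = b")
      case True
      then show ?thesis
        using rspan_base by (intro bexI[of _ Y] bexI[of _ "\<lambda>_. 0"]) (auto intro: rspan.rspan_zero)
    next
      case False
      then have "(\<lambda>\<omega>. Y \<omega> *\<^sub>R c) \<in> rspan M B"
        using rspan_base by (auto intro: rspan.rspan_base)
      then show ?thesis
        by (rule bexI[of _ "\<lambda>_. 0", OF bexI[rotated]]) (auto intro: L_inf_minus_const)
    qed
  next
    case (rspan_add T1 T2)
    then obtain Z1 S1 Z2 S2 where *: "Z1 \<in> L_inf_minus M" "S1 \<in> rspan M B" "\<forall>\<omega>. T1 \<omega> = Z1 \<omega> *\<^sub>R b + S1 \<omega>"
      "Z2 \<in> L_inf_minus M" "S2 \<in> rspan M B" "\<forall>\<omega>. T2 \<omega> = Z2 \<omega> *\<^sub>R b + S2 \<omega>"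
      by blast
    show ?case
      by (rule bexI[of _ "\<lambda>\<omega>. Z1 \<omega> + Z2 \<omega>", OF bexI[of _ "\<lambda>\<omega>. S1 \<omega> + S2 \<omega>"]])
        (use * in \<open>auto simp: scaleR_add_left intro: rspan.rspan_add L_inf_minus_add\<close>)
  qed
  then show ?thesis using that by blast
qed

end

section \<open>The Wei-Norman method\<close>

lemma bilinear_ad: "bilinear (ad :: 'a \<Rightarrow> 'a \<Rightarrow> 'a::real_algebra_1)"
  by (auto simp: bilinear_def ad_def linear_iff algebra_simps)

lemma fps_ad_nth: "fps_nth (ad X Y) i = (\<Sum>j\<le>i. ad (fps_nth X j) (fps_nth Y (i - j)))"
proof -
  have "(\<Sum>j\<le>i. fps_nth Y j * fps_nth X (i - j)) = (\<Sum>j\<le>i. fps_nth Y (i - j) * fps_nth X j)"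
    by (rule sum.reindex_bij_witness[where i = "\<lambda>j. i - j" and j = "\<lambda>j. i - j"]) auto
  then show ?thesis
    by (simp add: ad_def fps_mult_nth sum_subtractf atLeast0AtMost)
qed

definition poly_series :: "real poly \<Rightarrow> 'a::real_vector \<Rightarrow> 'a fps"
  where "poly_series p b = Abs_fps (\<lambda>i. coeff p i *\<^sub>R b)"

lemma poly_series_nth [simp]: "fps_nth (poly_series p b) i = coeff p i *\<^sub>R b"
  by (simp add: poly_series_def)

lemma texp_nth_0: "fps_nth X 0 = 0 \<Longrightarrow> fps_nth (texp m X) 0 = (1 :: 'a::real_algebra_1)"
  unfolding texp_def lessThan_Suc_atMost[symmetric] sum.lessThan_Suc_shift
  by (simp add: fps_sum_nth fps_power_nth_eq_0)

lemma prod_list_nth_0: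
  "(\<And>X. X \<in> set Xs \<Longrightarrow> fps_nth X 0 = 1) \<Longrightarrow> fps_nth (prod_list Xs) 0 = (1 :: 'a::real_algebra_1)"
  by (induction Xs) (auto simp: fps_mult_nth_0)

section \<open>Series with coefficients in the span of the \<open>w n\<close>\<close>

locale witt_algebra = prob_space M for M :: "'w measure" +
  fixes w :: "nat \<Rightarrow> 'a::real_algebra_1" and \<alpha> :: "nat \<Rightarrow> nat \<Rightarrow> real"
  assumes ad_w: "ad (w n) (w k) = \<alpha> n k *\<^sub>R w (n + k)"
begin

text \<open>The bound \<open>n \<le> q * i\<close> on the indices at order \<open>i\<close> is preserved by brackets, as indices and
  orders both add; it makes all indices above \<open>m * q\<close> invisible up to order \<open>m\<close>.\<close>

definition lie_series :: "nat \<Rightarrow> nat \<Rightarrow> ('w \<Rightarrow> 'a fps) set"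
  where "lie_series q r = {A. (\<forall>\<omega>. fps_nth (A \<omega>) 0 = 0) \<and>
    (\<forall>i. (\<lambda>\<omega>. fps_nth (A \<omega>) i) \<in> rspan M (w ` {r..q * i}))}"

lemma lie_series_nth_0: "A \<in> lie_series q r \<Longrightarrow> fps_nth (A \<omega>) 0 = 0"
  by (simp add: lie_series_def)

lemma lie_series_zero: "(\<lambda>_. 0) \<in> lie_series q r"
  by (simp add: lie_series_def rspan_zero)

lemma lie_series_add: "A \<in> lie_series q r \<Longrightarrow> B \<in> lie_series q r \<Longrightarrow> (\<lambda>\<omega>. A \<omega> + B \<omega>) \<in> lie_series q r"
  by (simp add: lie_series_def rspan_add)

lemma lie_series_scaleR: "A \<in> lie_series q r \<Longrightarrow> (\<lambda>\<omega>. c *\<^sub>R A \<omega>) \<in> lie_series q r"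
  by (simp add: lie_series_def rspan_cscaleR)

lemma lie_series_minus: "A \<in> lie_series q r \<Longrightarrow> (\<lambda>\<omega>. - A \<omega>) \<in> lie_series q r"
  by (simp add: lie_series_def rspan_minus)

lemma lie_series_euler: "A \<in> lie_series q r \<Longrightarrow> (\<lambda>\<omega>. fps_euler (A \<omega>)) \<in> lie_series q r"
  by (simp add: lie_series_def rspan_cscaleR)

lemma lie_series_sum:
  "(\<And>a. a \<in> I \<Longrightarrow> A a \<in> lie_series q r) \<Longrightarrow> (\<lambda>\<omega>. \<Sum>a\<in>I. A a \<omega>) \<in> lie_series q r"
  by (induction I rule: infinite_finite_induct) (auto intro: lie_series_zero lie_series_add)

text \<open>Of the two lower bounds on indices that of \<open>B\<close> survives, since an index k
  >= s only grows when n is added. Conjugating with an exponential built from \<open>w r\<close>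
  therefore cannot bring back an index that has been removed from \<open>B\<close>.\<close>

lemma lie_series_ad:
  assumes A: "A \<in> lie_series q r" and B: "B \<in> lie_series q s"
  shows "(\<lambda>\<omega>. ad (A \<omega>) (B \<omega>)) \<in> lie_series q s"
proof -
  have "(\<lambda>\<omega>. ad (fps_nth (A \<omega>) j) (fps_nth (B \<omega>) (i - j))) \<in> rspan M (w ` {s..q * i})"
    if "j \<le> i" for i j
  proof (rule rspan_bilinear[OF bilinear_ad])
    show "(\<lambda>\<omega>. fps_nth (A \<omega>) j) \<in> rspan M (w ` {r..q * j})"
      "(\<lambda>\<omega>. fps_nth (B \<omega>) (i - j)) \<in> rspan M (w ` {s..q * (i - j)})"
      using A B by (auto simp: lie_series_def)
    fix b c assume "b \<in> w ` {r..q * j}" "c \<in> w ` {s..q * (i - j)}"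
    then obtain n k where *: "b = w n" "c = w k" "n \<le> q * j" "s \<le> k" "k \<le> q * (i - j)"
      by auto
    have "q * j + q * (i - j) = q * i"
      using that by (simp add: distrib_left[symmetric])
    with * have "n + k \<in> {s..q * i}"
      by auto
    then show "(\<lambda>_. ad b c) \<in> rspan M (w ` {s..q * i})"
      unfolding * ad_w by (intro rspan_cscaleR rspan_const) auto
  qed
  then show ?thesis
    by (auto simp: lie_series_def fps_ad_nth lie_series_nth_0[OF A] bilinear_lzero[OF bilinear_ad]
        intro!: rspan_sum)
qed

lemma lie_series_ad_power:
  assumes "A \<in> lie_series q r" "B \<in> lie_series q s"
  shows "(\<lambda>\<omega>. (ad (A \<omega>) ^^ k) (B \<omega>)) \<in> lie_series q s"
  by (induction k) (auto intro: assms lie_series_ad)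

lemma lie_series_texp_ad:
  assumes "A \<in> lie_series q r" "B \<in> lie_series q s"
  shows "(\<lambda>\<omega>. texp_ad m (A \<omega>) (B \<omega>)) \<in> lie_series q s"
  unfolding texp_ad_def by (intro lie_series_sum lie_series_scaleR lie_series_ad_power[OF assms])

lemma lie_series_tdexp:
  assumes "A \<in> lie_series q r" "B \<in> lie_series q s"
  shows "(\<lambda>\<omega>. tdexp m (A \<omega>) (B \<omega>)) \<in> lie_series q s"
  unfolding tdexp_def by (intro lie_series_sum lie_series_scaleR lie_series_ad_power[OF assms])

text \<open>For a product E R the Leibniz rule gives (\<theta>E) R + E (\<theta>R). The first term
  is handled by \<open>texp_euler\<close>; in the second, E is moved past the logarithmic derivative
  of R by conjugation. Both operations consist of brackets, so they do not leave
  \<open>lie_series\<close>.\<close>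

lemma prod_texp_log_derivative:
  assumes "set Xs \<subseteq> lie_series q r"
  shows "\<exists>A\<in>lie_series q r. \<forall>\<omega>. fps_agree m (fps_euler (prod_list (map (\<lambda>X. texp m (X \<omega>)) Xs)))
    (A \<omega> * prod_list (map (\<lambda>X. texp m (X \<omega>)) Xs))"
  using assms
proof (induction Xs)
  case Nil
  show ?case by (rule bexI[OF _ lie_series_zero]) simp
next
  case (Cons X Xs)
  let ?R = "\<lambda>\<omega>. prod_list (map (\<lambda>X. texp m (X \<omega>)) Xs)" and ?E = "\<lambda>\<omega>. texp m (X \<omega>)"
  have X: "X \<in> lie_series q r" using Cons by simp
  note X0 = lie_series_nth_0[OF X]
  obtain A where A: "A \<in> lie_series q r" and R: "\<And>\<omega>. fps_agree m (fps_euler (?R \<omega>)) (A \<omega> * ?R \<omega>)"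
    using Cons by auto
  let ?D = "\<lambda>\<omega>. tdexp m (X \<omega>) (fps_euler (X \<omega>))" and ?A = "\<lambda>\<omega>. texp_ad m (X \<omega>) (A \<omega>)"
  have "fps_agree m (fps_euler (?E \<omega> * ?R \<omega>)) ((?D \<omega> + ?A \<omega>) * (?E \<omega> * ?R \<omega>))" for \<omega>
  proof -
    have "fps_euler (?E \<omega> * ?R \<omega>) = fps_euler (?E \<omega>) * ?R \<omega> + ?E \<omega> * fps_euler (?R \<omega>)"
      by (rule fps_euler_mult)
    also have "fps_agree m \<dots> (?D \<omega> * ?E \<omega> * ?R \<omega> + ?E \<omega> * (A \<omega> * ?R \<omega>))"
      by (intro fps_agree_add fps_agree_mult fps_agree_refl texp_euler R X0)
    also have "\<dots> = ?D \<omega> * ?E \<omega> * ?R \<omega> + (?E \<omega> * A \<omega>) * ?R \<omega>"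
      by (simp add: mult.assoc)
    also have "fps_agree m \<dots> (?D \<omega> * ?E \<omega> * ?R \<omega> + (?A \<omega> * ?E \<omega>) * ?R \<omega>)"
      by (intro fps_agree_add fps_agree_mult fps_agree_refl texp_conjugate X0)
    also have "\<dots> = (?D \<omega> + ?A \<omega>) * (?E \<omega> * ?R \<omega>)"
      by (simp add: algebra_simps)
    finally show ?thesis .
  qed
  then show ?case
    by (intro bexI[of _ "\<lambda>\<omega>. ?D \<omega> + ?A \<omega>"] lie_series_add lie_series_tdexp[OF X] lie_series_euler X
        lie_series_texp_ad[OF X A]) simp
qed

text \<open>Where q * i < r the index r cannot occur, and the coefficient is chosen to be 0 there,
  so that the coefficient series times \<open>w r\<close> again obeys the index bound of
  \<open>lie_series\<close>. Vanishing at order 0 permits the later division by i.\<close>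

lemma lie_series_split:
  assumes A: "A \<in> lie_series q r"
  obtains Z B where "\<And>i. Z i \<in> L_inf_minus M" "B \<in> lie_series q (Suc r)"
    "\<And>i \<omega>. q * i < r \<or> i = 0 \<Longrightarrow> Z i \<omega> = 0"
    "\<And>\<omega>. A \<omega> = Abs_fps (\<lambda>i. Z i \<omega> *\<^sub>R w r) + B \<omega>"
proof -
  have "\<exists>Z S. Z \<in> L_inf_minus M \<and> S \<in> rspan M (w ` {Suc r..q * i}) \<and>
      (\<forall>\<omega>. fps_nth (A \<omega>) i = Z \<omega> *\<^sub>R w r + S \<omega>) \<and> (q * i < r \<or> i = 0 \<longrightarrow> (\<forall>\<omega>. Z \<omega> = 0)) \<and>
      (i = 0 \<longrightarrow> (\<forall>\<omega>. S \<omega> = 0))" for i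
  proof (cases "q * i < r \<or> i = 0")
    case True
    have "fps_nth (A \<omega>) i = 0" for \<omega>
    proof (cases "i = 0")
      case False
      then have "(\<lambda>\<omega>. fps_nth (A \<omega>) i) \<in> rspan M {}"
        using A True by (auto simp: lie_series_def dest: spec[of _ i])
      then show ?thesis by (auto dest: rspan_empty fun_cong)
    qed (simp add: lie_series_nth_0[OF A])
    then show ?thesis
      by (intro exI[of _ "\<lambda>_. 0"]) (auto intro: L_inf_minus_const rspan_zero)
  next
    case False
    then have "w ` {r..q * i} = insert (w r) (w ` {Suc r..q * i})"
      by (simp add: atLeastAtMost_insertL[symmetric] del: atLeastAtMost_insertL)
    moreover have "(\<lambda>\<omega>. fps_nth (A \<omega>) i) \<in> rspan M (w ` {r..q * i})"
      using A by (simp add: lie_series_def)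
    ultimately obtain Z S where "Z \<in> L_inf_minus M" "S \<in> rspan M (w ` {Suc r..q * i})"
      "\<And>\<omega>. fps_nth (A \<omega>) i = Z \<omega> *\<^sub>R w r + S \<omega>"
      using rspan_insert by metis
    then show ?thesis using False by blast
  qed
  then obtain Z S where *: "\<And>i. Z i \<in> L_inf_minus M" "\<And>i. S i \<in> rspan M (w ` {Suc r..q * i})"
    "\<And>i \<omega>. fps_nth (A \<omega>) i = Z i \<omega> *\<^sub>R w r + S i \<omega>" "\<And>i \<omega>. q * i < r \<or> i = 0 \<Longrightarrow> Z i \<omega> = 0"
    "\<And>\<omega>. S 0 \<omega> = 0"
    by metis
  show ?thesis
    by (rule that[of Z "\<lambda>\<omega>. Abs_fps (\<lambda>i. S i \<omega>)"]) (use * in \<open>auto simp: lie_series_def fps_eq_iff\<close>)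
qed

text \<open>Induction on the number j of indices r, ..., K still to be peeled off. When none is
  left, all indices in \<open>A\<close> exceed K >= m * q and so occur only above order m; then
  \<open>A\<close> vanishes up to order m and the empty product solves the equation.\<close>

lemma wei_norman:
  assumes "A \<in> lie_series q r" "m \<ge> 1" "m * q \<le> K" "r + j = Suc K"
  shows "\<exists>P. (\<forall>n. P n \<in> Rpoly_star M) \<and> (\<forall>\<omega>. fps_agree m
    (fps_euler (prod_list (map (\<lambda>n. texp m (poly_series (P n \<omega>) (w n))) [r..<Suc K])))
    (A \<omega> * prod_list (map (\<lambda>n. texp m (poly_series (P n \<omega>) (w n))) [r..<Suc K])))"
  using assms(1,4)
proof (induction j arbitrary: r A)
  case 0
  have "fps_nth (A \<omega>) i = 0" if "i \<le> m" for i \<omega>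
  proof -
    have "q * i \<le> K"
      using order_trans[OF mult_le_mono1[OF that, of q] assms(3)] by (simp only: mult.commute)
    then have "(\<lambda>\<omega>. fps_nth (A \<omega>) i) \<in> rspan M {}"
      using 0 by (auto simp: lie_series_def dest: spec[of _ i])
    then show ?thesis by (auto dest: rspan_empty fun_cong)
  qed
  then show ?case
    using 0 by (intro exI[of _ "\<lambda>_ _. 0"]) (auto simp: Rpoly_star_0 fps_agree_def)
next
  case (Suc j)
  obtain Z B where Z: "\<And>i. Z i \<in> L_inf_minus M" and B: "B \<in> lie_series q (Suc r)"
    and Z0: "\<And>i \<omega>. q * i < r \<or> i = 0 \<Longrightarrow> Z i \<omega> = 0"
    and A: "\<And>\<omega>. A \<omega> = Abs_fps (\<lambda>i. Z i \<omega> *\<^sub>R w r) + B \<omega>"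
    using lie_series_split[OF Suc.prems(1)] by metis
  \<comment> \<open>\<open>p\<close> solves \<theta>p = Z up to order m, by dividing the i-th
    coefficient by i. Orders above m are cut off to obtain a polynomial.\<close>
  define p where "p \<omega> = (\<Sum>i=1..m. monom ((1 / real i) * Z i \<omega>) i)" for \<omega>
  have p: "p \<in> Rpoly_star M"
    unfolding p_def by (intro Rpoly_starI L_inf_minus_cmult Z \<open>m \<ge> 1\<close>)
  have coeff_p: "coeff (p \<omega>) i = (if i \<in> {1..m} then Z i \<omega> / real i else 0)" for \<omega> i
    by (simp add: p_def coeff_sum)
  define X where "X \<omega> = poly_series (p \<omega>) (w r)" for \<omega>
  have X: "X \<in> lie_series q r"
    unfolding lie_series_def
  proof (intro CollectI conjI allI)
    show "(\<lambda>\<omega>. fps_nth (X \<omega>) i) \<in> rspan M (w ` {r..q * i})" for i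
    proof (cases "q * i < r \<or> i = 0 \<or> i > m")
      case True
      then have "fps_nth (X \<omega>) i = 0" for \<omega>
        by (auto simp: X_def coeff_p Z0)
      then show ?thesis by (simp add: rspan_zero)
    next
      case False
      have "(\<lambda>\<omega>. (1 / real i) *\<^sub>R Z i \<omega> *\<^sub>R w r) \<in> rspan M (w ` {r..q * i})"
        by (intro rspan_cscaleR rspan_base Z) (use False in auto)
      then show ?thesis using False by (simp add: X_def coeff_p)
    qed
  qed (simp add: X_def coeff_p)
  note X0 = lie_series_nth_0[OF X]
  \<comment> \<open>With U = E R, the equation left for R has the coefficient E^(-1) B E, whose
    indices are still above r.\<close>
  have B': "(\<lambda>\<omega>. texp_ad m (- X \<omega>) (B \<omega>)) \<in> lie_series q (Suc r)"
    by (rule lie_series_texp_ad[OF lie_series_minus[OF X] B])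
  obtain P where P: "\<And>n. P n \<in> Rpoly_star M" and R: "\<And>\<omega>. fps_agree m
    (fps_euler (prod_list (map (\<lambda>n. texp m (poly_series (P n \<omega>) (w n))) [Suc r..<Suc K])))
    (texp_ad m (- X \<omega>) (B \<omega>) * prod_list (map (\<lambda>n. texp m (poly_series (P n \<omega>) (w n))) [Suc r..<Suc K]))"
    using Suc.IH[OF B'] Suc.prems by auto
  define E where "E \<omega> = texp m (X \<omega>)" for \<omega>
  define R where "R \<omega> = prod_list (map (\<lambda>n. texp m (poly_series (P n \<omega>) (w n))) [Suc r..<Suc K])" for \<omega>
  have "fps_agree m (fps_euler (E \<omega> * R \<omega>)) (A \<omega> * (E \<omega> * R \<omega>))" for \<omega>
  proof -
    let ?B = "texp_ad m (- X \<omega>) (B \<omega>)" and ?Y = "fps_euler (X \<omega>)"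
    \<comment> \<open>X and \<theta>X are both scalar series times \<open>w r\<close> and commute,
      so only the term j = 0 of \<open>tdexp\<close> remains and exp(X) is differentiated as in a
      commutative algebra.\<close>
    have "ad (X \<omega>) ?Y = 0"
      by (rule fps_ext, unfold fps_ad_nth) (simp add: X_def ad_def mult_ac)
    then have "(ad (X \<omega>) ^^ j) ?Y = (if j = 0 then ?Y else 0)" for j
      by (induction j) auto
    then have "tdexp m (X \<omega>) ?Y = (\<Sum>j\<le>m. if j = 0 then ?Y else 0)"
      unfolding tdexp_def by (intro sum.cong) auto
    then have D: "tdexp m (X \<omega>) ?Y = ?Y"
      by simp
    have E: "fps_agree m (fps_euler (E \<omega>)) (?Y * E \<omega>)"
      using texp_euler[OF X0, of m \<omega>] unfolding D E_def .
    have Y: "fps_agree m ?Y (Abs_fps (\<lambda>i. Z i \<omega> *\<^sub>R w r))"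
      by (auto simp: fps_agree_def X_def coeff_p Z0)
    have "fps_euler (E \<omega> * R \<omega>) = fps_euler (E \<omega>) * R \<omega> + E \<omega> * fps_euler (R \<omega>)"
      by (rule fps_euler_mult)
    also have "fps_agree m \<dots> (?Y * E \<omega> * R \<omega> + E \<omega> * (?B * R \<omega>))"
      by (intro fps_agree_add fps_agree_mult fps_agree_refl E R[folded R_def])
    also have "\<dots> = ?Y * E \<omega> * R \<omega> + (E \<omega> * ?B) * R \<omega>"
      by (simp add: mult.assoc)
    also have "fps_agree m \<dots> (Abs_fps (\<lambda>i. Z i \<omega> *\<^sub>R w r) * E \<omega> * R \<omega> + (B \<omega> * E \<omega>) * R \<omega>)"
      unfolding E_def by (intro fps_agree_add fps_agree_mult fps_agree_refl texp_conjugate_minus X0 Y)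
    also have "\<dots> = A \<omega> * (E \<omega> * R \<omega>)"
      by (simp add: A algebra_simps)
    finally show ?thesis .
  qed
  moreover have "E \<omega> * R \<omega> = prod_list (map (\<lambda>n. texp m (poly_series ((P(r := p)) n \<omega>) (w n))) [r..<Suc K])" for \<omega>
  proof -
    have "[r..<Suc K] = r # [Suc r..<Suc K]"
      using Suc.prems by (simp add: upt_conv_Cons del: upt_Suc)
    moreover have "map (\<lambda>n. texp m (poly_series ((P(r := p)) n \<omega>) (w n))) [Suc r..<Suc K]
        = map (\<lambda>n. texp m (poly_series (P n \<omega>) (w n))) [Suc r..<Suc K]"
      by (rule map_cong) auto
    ultimately show ?thesis
      by (simp only: E_def R_def X_def list.map prod_list.Cons fun_upd_same)
  qed
  ultimately show ?case
    using P p by (intro exI[of _ "P(r := p)"]) auto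
qed

theorem prod_texp_ordered:
  assumes Xs: "set Xs \<subseteq> lie_series q 0" and "m \<ge> 1" "m * q \<le> K"
  obtains P where "\<And>n. P n \<in> Rpoly_star M"
    "\<And>\<omega>. fps_agree m (prod_list (map (\<lambda>X. texp m (X \<omega>)) Xs))
      (prod_list (map (\<lambda>n. texp m (poly_series (P n \<omega>) (w n))) [0..<Suc K]))"
proof -
  obtain A where A: "A \<in> lie_series q 0" and U: "\<And>\<omega>. fps_agree m
    (fps_euler (prod_list (map (\<lambda>X. texp m (X \<omega>)) Xs))) (A \<omega> * prod_list (map (\<lambda>X. texp m (X \<omega>)) Xs))"
    using prod_texp_log_derivative[OF Xs, of m] by auto
  obtain P where P: "\<And>n. P n \<in> Rpoly_star M" and V: "\<And>\<omega>. fps_agree m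
    (fps_euler (prod_list (map (\<lambda>n. texp m (poly_series (P n \<omega>) (w n))) [0..<Suc K])))
    (A \<omega> * prod_list (map (\<lambda>n. texp m (poly_series (P n \<omega>) (w n))) [0..<Suc K]))"
    using wei_norman[OF A assms(2,3), of "Suc K"] by auto
  have P0: "coeff (P n \<omega>) 0 = 0" for n \<omega>
    using Rpoly_star_coeff[OF P[of n]] by metis
  show ?thesis
  proof (rule that[OF P])
    fix \<omega>
    show "fps_agree m (prod_list (map (\<lambda>X. texp m (X \<omega>)) Xs))
      (prod_list (map (\<lambda>n. texp m (poly_series (P n \<omega>) (w n))) [0..<Suc K]))"
    proof (rule fps_euler_eq_unique[OF U V])
      have "fps_nth (prod_list (map (\<lambda>X. texp m (X \<omega>)) Xs)) 0 = 1"
        using Xs by (intro prod_list_nth_0) (auto simp: texp_nth_0 lie_series_nth_0)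
      moreover have "fps_nth (prod_list (map (\<lambda>n. texp m (poly_series (P n \<omega>) (w n))) [0..<Suc K])) 0 = 1"
        by (intro prod_list_nth_0) (auto simp: texp_nth_0 P0 simp del: upt_Suc)
      ultimately show "fps_nth (prod_list (map (\<lambda>X. texp m (X \<omega>)) Xs)) 0 =
        fps_nth (prod_list (map (\<lambda>n. texp m (poly_series (P n \<omega>) (w n))) [0..<Suc K])) 0"
        by (simp only:)
    qed (rule lie_series_nth_0[OF A])
  qed
qed

end

section \<open>Differential operators on bounded smooth functions\<close>

lemma Cb_infinity_differentiable: "f \<in> Cb_infinity \<Longrightarrow> f differentiable (at x)"
  unfolding Cb_infinity_def smooth_functions_def iter_partial_def mem_Collect_eq
  by (elim conjE, drule spec[of _ "[]"], drule spec[of _ x]) simp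

lemma Cb_infinity_smooth: "f \<in> Cb_infinity \<Longrightarrow> f \<in> smooth_functions"
  by (simp add: Cb_infinity_def)

lemma Cb_infinity_bounded: "f \<in> Cb_infinity \<Longrightarrow> bounded (range f)"
  unfolding Cb_infinity_def iter_partial_def mem_Collect_eq
  by (elim conjE, drule spec[of _ "[]"]) simp

lemma Cb_infinity_partial: "f \<in> Cb_infinity \<Longrightarrow> partial_deriv j f \<in> Cb_infinity"
proof -
  assume f: "f \<in> Cb_infinity"
  have "iter_partial js (partial_deriv j f) = iter_partial (js @ [j]) f" for js
    by (simp add: iter_partial_def)
  with f show ?thesis
    by (simp add: Cb_infinity_def smooth_functions_def)
qed

text \<open>Spares inductions over multi-indices and Leibniz formulas of higher order: it suffices
  to exhibit an invariant set of functions, as all iterated partial derivatives then remain in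
  it.\<close>

lemma Cb_infinity_coinduct:
  assumes "f \<in> S" and "\<And>g x. g \<in> S \<Longrightarrow> g differentiable (at x)"
    and "\<And>g. g \<in> S \<Longrightarrow> bounded (range g)" and "\<And>g j. g \<in> S \<Longrightarrow> partial_deriv j g \<in> S"
  shows "f \<in> Cb_infinity"
proof -
  have "iter_partial js f \<in> S" for js
    by (induction js) (simp_all add: iter_partial_def assms)
  then show ?thesis
    by (simp add: Cb_infinity_def smooth_functions_def assms)
qed

lemma partial_derivI: "(f has_derivative f') (at x) \<Longrightarrow> partial_deriv j f x = f' (axis j 1)"
  unfolding partial_deriv_def by (simp add: frechet_derivative_at[symmetric])

lemma frechet_derivative_has: "f differentiable (at x) \<Longrightarrow> (f has_derivative frechet_derivative f (at x)) (at x)"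
  by (simp add: frechet_derivative_works)

lemma partial_deriv_add:
  assumes "\<And>x. f differentiable (at x)" "\<And>x. g differentiable (at x)"
  shows "partial_deriv j (\<lambda>x. f x + g x) = (\<lambda>x. partial_deriv j f x + partial_deriv j g x)"
proof
  fix x
  show "partial_deriv j (\<lambda>x. f x + g x) x = partial_deriv j f x + partial_deriv j g x"
    by (subst partial_derivI[OF has_derivative_add[OF frechet_derivative_has frechet_derivative_has]])
      (simp_all add: assms partial_deriv_def)
qed

lemma partial_deriv_mult:
  fixes f g :: "real^'n::finite \<Rightarrow> real"
  assumes "\<And>x. f differentiable (at x)" "\<And>x. g differentiable (at x)"
  shows "partial_deriv j (\<lambda>x. f x * g x) = (\<lambda>x. f x * partial_deriv j g x + partial_deriv j f x * g x)"
proof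
  fix x
  show "partial_deriv j (\<lambda>x. f x * g x) x = f x * partial_deriv j g x + partial_deriv j f x * g x"
    by (subst partial_derivI[OF has_derivative_mult[OF frechet_derivative_has frechet_derivative_has]])
      (simp_all add: assms partial_deriv_def)
qed

lemma Cb_infinity_const: "(\<lambda>_. c) \<in> Cb_infinity"
proof (rule Cb_infinity_coinduct[where S = "range (\<lambda>c _. c)"])
  fix g :: "real^'a \<Rightarrow> 'b" and j assume "g \<in> range (\<lambda>c _. c)"
  then obtain c where g: "g = (\<lambda>_. c)" by auto
  have "partial_deriv j g = (\<lambda>_. 0)"
    unfolding g by (rule ext, subst partial_derivI[OF has_derivative_const]) simp
  then show "partial_deriv j g \<in> range (\<lambda>c _. c)" by simp
qed auto

lemma bounded_range_iff: "bounded (range f) \<longleftrightarrow> (\<exists>B\<ge>0. \<forall>x. norm (f x) \<le> B)"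
  unfolding bounded_iff by (auto intro: max.cobounded2 max.coboundedI1)

lemma Cb_infinity_lincomb:
  fixes f g :: "real^'n::finite \<Rightarrow> 'b::real_normed_vector"
  assumes "f \<in> Cb_infinity" "g \<in> Cb_infinity"
  shows "(\<lambda>x. a *\<^sub>R f x + g x) \<in> Cb_infinity"
proof (rule Cb_infinity_coinduct[where
      S = "{\<lambda>x. a *\<^sub>R f x + g x |f g. f \<in> Cb_infinity \<and> g \<in> Cb_infinity}"])
  fix h :: "real^'n \<Rightarrow> 'b" and j x
  assume "h \<in> {\<lambda>x. a *\<^sub>R f x + g x |f g. f \<in> Cb_infinity \<and> g \<in> Cb_infinity}"
  then obtain f g where fg: "f \<in> Cb_infinity" "g \<in> Cb_infinity" and h: "h = (\<lambda>x. a *\<^sub>R f x + g x)"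
    by auto
  have D: "(h has_derivative (\<lambda>v. a *\<^sub>R frechet_derivative f (at x) v + frechet_derivative g (at x) v)) (at x)" for x
    unfolding h by (intro has_derivative_add has_derivative_scaleR_right frechet_derivative_has
        Cb_infinity_differentiable fg)
  then show "h differentiable (at x)"
    by (rule differentiableI)
  obtain B C where "\<forall>x. norm (f x) \<le> B" "\<forall>x. norm (g x) \<le> C"
    using fg[THEN Cb_infinity_bounded] by (auto simp: bounded_range_iff)
  then have "norm (h x) \<le> \<bar>a\<bar> * B + C" for x
    unfolding h by (intro norm_triangle_le add_mono) (auto intro: mult_left_mono)
  then show "bounded (range h)" by (auto simp: bounded_iff)
  have "partial_deriv j h = (\<lambda>x. a *\<^sub>R partial_deriv j f x + partial_deriv j g x)"
    by (rule ext, subst partial_derivI[OF D]) (simp add: partial_deriv_def)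
  then show "partial_deriv j h \<in> {\<lambda>x. a *\<^sub>R f x + g x |f g. f \<in> Cb_infinity \<and> g \<in> Cb_infinity}"
    using fg[THEN Cb_infinity_partial] by blast
qed (use assms in blast)

text \<open>The product rule turns a product into a sum of products, so closure under partial
  derivatives is evident for the generated algebra; this makes \<open>Cb_infinity_coinduct\<close>
  applicable to products.\<close>

inductive_set cb_alg :: "(real^'n::finite \<Rightarrow> real) set" where
  cb_alg_base: "f \<in> Cb_infinity \<Longrightarrow> f \<in> cb_alg"
| cb_alg_add: "f \<in> cb_alg \<Longrightarrow> g \<in> cb_alg \<Longrightarrow> (\<lambda>x. f x + g x) \<in> cb_alg"
| cb_alg_mult: "f \<in> cb_alg \<Longrightarrow> g \<in> cb_alg \<Longrightarrow> (\<lambda>x. f x * g x) \<in> cb_alg"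

lemma cb_alg_differentiable: "f \<in> cb_alg \<Longrightarrow> f differentiable (at x)"
  by (induction rule: cb_alg.induct) (auto intro: Cb_infinity_differentiable)

lemma cb_alg_bounded: "f \<in> cb_alg \<Longrightarrow> bounded (range f)"
proof (induction rule: cb_alg.induct)
  case (cb_alg_add f g)
  then obtain B C where "\<forall>x. norm (f x) \<le> B" "\<forall>x. norm (g x) \<le> C"
    by (auto simp: bounded_range_iff)
  then have "\<forall>x. norm (f x + g x) \<le> B + C"
    by (meson add_mono norm_triangle_ineq order_trans)
  then show ?case by (auto simp: bounded_iff)
next
  case (cb_alg_mult f g)
  then obtain B C where "B \<ge> 0" "\<forall>x. norm (f x) \<le> B" "\<forall>x. norm (g x) \<le> C"
    by (auto simp: bounded_range_iff)
  then have "\<forall>x. norm (f x * g x) \<le> B * C"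
    by (auto simp: abs_mult intro!: mult_mono)
  then show ?case by (auto simp: bounded_iff)
qed (rule Cb_infinity_bounded)

lemma cb_alg_partial: "f \<in> cb_alg \<Longrightarrow> partial_deriv j f \<in> cb_alg"
  by (induction rule: cb_alg.induct)
    (auto simp: partial_deriv_add partial_deriv_mult cb_alg_differentiable
      intro: cb_alg.intros Cb_infinity_partial)

lemma cb_alg_imp_Cb_infinity: "f \<in> cb_alg \<Longrightarrow> f \<in> Cb_infinity"
  by (rule Cb_infinity_coinduct[where S = cb_alg])
    (auto intro: cb_alg_differentiable cb_alg_bounded cb_alg_partial)

lemma Cb_infinity_add:
  fixes f g :: "real^'n::finite \<Rightarrow> real"
  shows "f \<in> Cb_infinity \<Longrightarrow> g \<in> Cb_infinity \<Longrightarrow> (\<lambda>x. f x + g x) \<in> Cb_infinity"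
  by (rule cb_alg_imp_Cb_infinity[OF cb_alg_add[OF cb_alg_base cb_alg_base]])

lemma Cb_infinity_mult:
  fixes f g :: "real^'n::finite \<Rightarrow> real"
  shows "f \<in> Cb_infinity \<Longrightarrow> g \<in> Cb_infinity \<Longrightarrow> (\<lambda>x. f x * g x) \<in> Cb_infinity"
  by (rule cb_alg_imp_Cb_infinity[OF cb_alg_mult[OF cb_alg_base cb_alg_base]])

lemma Cb_infinity_cmult:
  fixes f :: "real^'n::finite \<Rightarrow> real"
  shows "f \<in> Cb_infinity \<Longrightarrow> (\<lambda>x. c * f x) \<in> Cb_infinity"
  by (rule Cb_infinity_mult[OF Cb_infinity_const])

lemma Cb_infinity_sum:
  fixes f :: "'i \<Rightarrow> real^'n::finite \<Rightarrow> real"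
  shows "(\<And>a. a \<in> A \<Longrightarrow> f a \<in> Cb_infinity) \<Longrightarrow> (\<lambda>x. \<Sum>a\<in>A. f a x) \<in> Cb_infinity"
  by (induction A rule: infinite_finite_induct) (auto intro: Cb_infinity_const Cb_infinity_add)

lemma Cb_infinity_component:
  fixes V :: "'n::finite vfield"
  assumes "V \<in> Cb_infinity"
  shows "(\<lambda>x. V x $ j) \<in> Cb_infinity"
proof (rule Cb_infinity_coinduct[where S = "(\<lambda>V x. V x $ j) ` Cb_infinity"])
  fix g i x assume "g \<in> (\<lambda>V x. V x $ j) ` (Cb_infinity :: 'n vfield set)"
  then obtain V :: "'n vfield" where V: "V \<in> Cb_infinity" "g = (\<lambda>x. V x $ j)" by auto
  have D: "(g has_derivative (\<lambda>h. frechet_derivative V (at x) h $ j)) (at x)" for x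
    unfolding V by (intro bounded_linear.has_derivative[OF bounded_linear_vec_nth]
      frechet_derivative_has Cb_infinity_differentiable V)
  then show "g differentiable (at x)"
    by (rule differentiableI)
  have "partial_deriv i g = (\<lambda>x. partial_deriv i V x $ j)"
    by (rule ext, subst partial_derivI[OF D]) (simp add: partial_deriv_def)
  then show "partial_deriv i g \<in> (\<lambda>V x. V x $ j) ` Cb_infinity"
    using Cb_infinity_partial[OF V(1)] by auto
  obtain B where "\<forall>x. norm (V x) \<le> B"
    using Cb_infinity_bounded[OF V(1)] by (auto simp: bounded_range_iff)
  then have "\<forall>x. norm (g x) \<le> B"
    unfolding V real_norm_def by (meson component_le_norm_cart order_trans)
  then show "bounded (range g)" by (auto simp: bounded_iff)
qed (use assms in auto)

lemma Cb_infinity_vf_op: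
  assumes "V \<in> Cb_infinity" "f \<in> Cb_infinity"
  shows "vf_op V f \<in> Cb_infinity"
  unfolding vf_op_def[abs_def]
  by (intro Cb_infinity_sum Cb_infinity_mult Cb_infinity_component Cb_infinity_partial assms)

lemma frechet_derivative_partial:
  fixes f :: "real^'n::finite \<Rightarrow> 'b::real_normed_vector"
  assumes "f differentiable (at x)"
  shows "frechet_derivative f (at x) h = (\<Sum>j\<in>UNIV. h $ j *\<^sub>R partial_deriv j f x)"
proof -
  interpret linear "frechet_derivative f (at x)"
    by (rule linear_frechet_derivative[OF assms])
  have "frechet_derivative f (at x) h = frechet_derivative f (at x) (\<Sum>j\<in>UNIV. h $ j *\<^sub>R axis j 1)"
    using basis_expansion[of h] by (simp add: scalar_mult_eq_scaleR)
  then show ?thesis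
    by (simp add: sum scale partial_deriv_def)
qed

lemma Cb_infinity_lipschitz:
  fixes f :: "real^'n::finite \<Rightarrow> 'b::real_normed_vector"
  assumes f: "f \<in> Cb_infinity"
  obtains L where "L \<ge> 0" "\<And>x y. norm (f x - f y) \<le> L * norm (x - y)"
proof -
  have "\<forall>j. \<exists>B\<ge>0. \<forall>x. norm (partial_deriv j f x) \<le> B"
    using Cb_infinity_bounded[OF Cb_infinity_partial[OF f]] by (simp add: bounded_range_iff)
  then obtain B where B: "\<And>j. B j \<ge> 0" "\<And>j x. norm (partial_deriv j f x) \<le> B j"
    by metis
  have bound: "norm (frechet_derivative f (at x) h) \<le> (\<Sum>j\<in>UNIV. B j) * norm h" for x h
  proof -
    have "norm (frechet_derivative f (at x) h) \<le> (\<Sum>j\<in>UNIV. norm h * B j)"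
      unfolding frechet_derivative_partial[OF Cb_infinity_differentiable[OF f]]
      by (intro sum_norm_le) (auto intro!: mult_mono component_le_norm_cart B)
    then show ?thesis by (simp add: sum_distrib_left mult.commute)
  qed
  have "norm (f x - f y) \<le> (\<Sum>j\<in>UNIV. B j) * norm (x - y)" for x y
    by (rule differentiable_bound[where S = UNIV and f' = "\<lambda>x. frechet_derivative f (at x)"])
      (auto intro!: onorm_le bound frechet_derivative_has Cb_infinity_differentiable f)
  then show ?thesis
    by (intro that[of "\<Sum>j\<in>UNIV. B j"]) (auto intro: sum_nonneg B)
qed

section \<open>The algebra of linear operators on bounded smooth functions\<close>

definition cb_linear :: "((real^'n::finite \<Rightarrow> real) \<Rightarrow> real^'n \<Rightarrow> real) \<Rightarrow> bool"
  where "cb_linear T \<longleftrightarrow> (\<forall>f\<in>Cb_infinity. T f \<in> Cb_infinity) \<and> (\<forall>f. f \<notin> Cb_infinity \<longrightarrow> T f = (\<lambda>_. 0)) \<and>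
    (\<forall>f\<in>Cb_infinity. \<forall>g\<in>Cb_infinity. \<forall>a. T (\<lambda>x. a * f x + g x) = (\<lambda>x. a * T f x + T g x))"

text \<open>Outside \<open>Cb_infinity\<close> an operator takes the junk value \<open>0\<close>, so that operators with the
  same action on \<open>Cb_infinity\<close> are equal.\<close>

typedef (overloaded) 'n cb_op = "{T :: (real^'n::finite \<Rightarrow> real) \<Rightarrow> real^'n \<Rightarrow> real. cb_linear T}"
  morphisms app Op
  by (rule exI[of _ "\<lambda>_ _. 0"]) (simp add: cb_linear_def Cb_infinity_const)

setup_lifting type_definition_cb_op

lemma cb_linear_in: "cb_linear T \<Longrightarrow> T f \<in> Cb_infinity"
  by (cases "f \<in> Cb_infinity") (auto simp: cb_linear_def Cb_infinity_const)

lemma cb_linear_out: "cb_linear T \<Longrightarrow> f \<notin> Cb_infinity \<Longrightarrow> T f = (\<lambda>_. 0)"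
  by (simp add: cb_linear_def)

lemma cb_linear_lincomb:
  "cb_linear T \<Longrightarrow> f \<in> Cb_infinity \<Longrightarrow> g \<in> Cb_infinity \<Longrightarrow>
    T (\<lambda>x. a * f x + g x) = (\<lambda>x. a * T f x + T g x)"
  by (simp add: cb_linear_def)

lemma cb_linear_zero: "cb_linear T \<Longrightarrow> T (\<lambda>_. 0) = (\<lambda>_. 0)"
  using cb_linear_lincomb[of T "\<lambda>_. 0" "\<lambda>_. 0" 1] by (simp add: Cb_infinity_const fun_eq_iff)

lemma cb_linear_add:
  "cb_linear T \<Longrightarrow> f \<in> Cb_infinity \<Longrightarrow> g \<in> Cb_infinity \<Longrightarrow> T (\<lambda>x. f x + g x) = (\<lambda>x. T f x + T g x)"
  using cb_linear_lincomb[of T f g 1] by simp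

lemma cb_linear_mult: "cb_linear T \<Longrightarrow> f \<in> Cb_infinity \<Longrightarrow> T (\<lambda>x. a * f x) = (\<lambda>x. a * T f x)"
  using cb_linear_lincomb[of T f "\<lambda>_. 0" a] by (simp add: Cb_infinity_const cb_linear_zero)

instantiation cb_op :: (finite) real_algebra_1
begin

lift_definition zero_cb_op :: "'a cb_op" is "\<lambda>_ _. 0"
  by (simp add: cb_linear_def Cb_infinity_const)

lift_definition one_cb_op :: "'a cb_op" is "\<lambda>f. if f \<in> Cb_infinity then f else (\<lambda>_. 0)"
  by (simp add: cb_linear_def Cb_infinity_cmult Cb_infinity_add)

lift_definition plus_cb_op :: "'a cb_op \<Rightarrow> 'a cb_op \<Rightarrow> 'a cb_op" is "\<lambda>S T f x. S f x + T f x"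
  by (auto simp: cb_linear_def algebra_simps intro: Cb_infinity_add)

lift_definition scaleR_cb_op :: "real \<Rightarrow> 'a cb_op \<Rightarrow> 'a cb_op" is "\<lambda>c T f x. c * T f x"
  by (auto simp: cb_linear_def algebra_simps intro: Cb_infinity_cmult)

definition uminus_cb_op :: "'a cb_op \<Rightarrow> 'a cb_op"
  where "uminus_cb_op T = (-1) *\<^sub>R T"

definition minus_cb_op :: "'a cb_op \<Rightarrow> 'a cb_op \<Rightarrow> 'a cb_op"
  where "minus_cb_op S T = S + (-1) *\<^sub>R T"

lift_definition times_cb_op :: "'a cb_op \<Rightarrow> 'a cb_op \<Rightarrow> 'a cb_op" is "\<lambda>S T f. S (T f)"
proof -
  fix S T :: "(real^'a \<Rightarrow> real) \<Rightarrow> real^'a \<Rightarrow> real"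
  assume ST: "cb_linear S" "cb_linear T"
  then show "cb_linear (\<lambda>f. S (T f))"
    using cb_linear_zero[OF ST(1)] unfolding cb_linear_def by auto
qed

instance
proof
  fix A B C :: "'a cb_op" and a b :: real
  show "A + B + C = A + (B + C)" "A + B = B + A" "0 + A = A"
    by (transfer, simp add: fun_eq_iff)+
  show "1 * A = A"
    by transfer (simp add: fun_eq_iff cb_linear_in)
  show "A * 1 = A"
    by transfer (simp add: fun_eq_iff cb_linear_zero cb_linear_out)
  show "A * B * C = A * (B * C)" "(A + B) * C = A * C + B * C"
    by (transfer, simp)+
  show "a *\<^sub>R (A + B) = a *\<^sub>R A + a *\<^sub>R B" "(a + b) *\<^sub>R A = a *\<^sub>R A + b *\<^sub>R A"
    "a *\<^sub>R b *\<^sub>R A = (a * b) *\<^sub>R A" "1 *\<^sub>R A = A" "a *\<^sub>R A * B = a *\<^sub>R (A * B)"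
    by (transfer, simp add: algebra_simps)+
  show "A - B = A + - B" "- A + A = 0"
    unfolding uminus_cb_op_def minus_cb_op_def by (transfer; simp add: fun_eq_iff)+
  show "A * (B + C) = A * B + A * C"
    by transfer (simp add: cb_linear_add cb_linear_in)
  show "A * a *\<^sub>R B = a *\<^sub>R (A * B)"
    by transfer (simp add: cb_linear_mult cb_linear_in)
  show "(0 :: 'a cb_op) \<noteq> 1"
  proof transfer
    show "(\<lambda>_ _. 0) \<noteq> (\<lambda>f :: real^'a \<Rightarrow> real. if f \<in> Cb_infinity then f else (\<lambda>_. 0))"
      by (rule notI, drule fun_cong[of _ _ "\<lambda>_. 1"], drule fun_cong[of _ _ 0]) (simp add: Cb_infinity_const)
  qed
qed

end

lemma app_Cb_infinity [simp]: "app T f \<in> Cb_infinity"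
  using app[of T] by (simp add: cb_linear_in)

lemma app_zero [simp]: "app 0 f x = 0"
  by transfer simp

lemma app_one: "f \<in> Cb_infinity \<Longrightarrow> app 1 f = f"
  by transfer simp

lemma app_add [simp]: "app (S + T) f x = app S f x + app T f x"
  by transfer simp

lemma app_scaleR [simp]: "app (c *\<^sub>R T) f x = c * app T f x"
  by transfer simp

lemma app_mult [simp]: "app (S * T) f = app S (app T f)"
  by transfer simp

lemma app_diff [simp]: "app (S - T) f x = app S f x - app T f x"
  unfolding minus_cb_op_def app_add app_scaleR by simp

lemma app_sum: "app (\<Sum>a\<in>A. T a) f x = (\<Sum>a\<in>A. app (T a) f x)"
  by (induction A rule: infinite_finite_induct) auto

lift_definition vf_cb_op :: "'n::finite vfield \<Rightarrow> 'n cb_op"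
  is "\<lambda>V f. if V \<in> Cb_infinity \<and> f \<in> Cb_infinity then vf_op V f else (\<lambda>_. 0)"
proof -
  fix V :: "'n vfield"
  have "vf_op V (\<lambda>x. a * f x + g x) = (\<lambda>x. a * vf_op V f x + vf_op V g x)"
    if "f \<in> Cb_infinity" "g \<in> Cb_infinity" for f g a
  proof -
    have "partial_deriv j (\<lambda>x. a * f x + g x) = (\<lambda>x. a * partial_deriv j f x + partial_deriv j g x)" for j
    proof
      fix x
      show "partial_deriv j (\<lambda>x. a * f x + g x) x = a * partial_deriv j f x + partial_deriv j g x"
        by (subst partial_derivI[OF has_derivative_add[OF has_derivative_mult_right[OF frechet_derivative_has]
              frechet_derivative_has]])
          (simp_all add: that Cb_infinity_differentiable partial_deriv_def)
    qed
    then show ?thesis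
      by (auto simp: vf_op_def fun_eq_iff sum_distrib_left sum.distrib[symmetric] algebra_simps)
  qed
  then show "cb_linear (\<lambda>f. if V \<in> Cb_infinity \<and> f \<in> Cb_infinity then vf_op V f else (\<lambda>_. 0))"
    by (auto simp: cb_linear_def Cb_infinity_const Cb_infinity_vf_op Cb_infinity_cmult Cb_infinity_add)
qed

lemma app_vf_cb_op: "V \<in> Cb_infinity \<Longrightarrow> f \<in> Cb_infinity \<Longrightarrow> app (vf_cb_op V) f = vf_op V f"
  by transfer simp

lemma app_eqI: "(\<And>f. f \<in> Cb_infinity \<Longrightarrow> app S f = app T f) \<Longrightarrow> S = T"
  by transfer (auto simp: cb_linear_def fun_eq_iff, metis)

lemma witt_condition_ad:
  assumes "witt_condition_via W d V"
  obtains \<alpha> where "\<And>n k. ad (vf_cb_op (W n)) (vf_cb_op (W k)) = \<alpha> n k *\<^sub>R vf_cb_op (W (n + k))"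
proof -
  have W: "W n \<in> Cb_infinity" for n
    using assms by (simp add: witt_condition_via_def)
  have "\<forall>n k. \<exists>a. \<forall>f\<in>smooth_functions. \<forall>x. commutator (W n) (W k) f x = a * vf_op (W (n + k)) f x"
    using assms unfolding witt_condition_via_def by blast
  then obtain \<alpha> where \<alpha>: "\<And>n k f x. f \<in> smooth_functions \<Longrightarrow>
      commutator (W n) (W k) f x = \<alpha> n k * vf_op (W (n + k)) f x"
    by metis
  have "ad (vf_cb_op (W n)) (vf_cb_op (W k)) = \<alpha> n k *\<^sub>R vf_cb_op (W (n + k))" for n k
  proof (intro app_eqI ext)
    fix f :: "real^'a \<Rightarrow> real" and x assume f: "f \<in> Cb_infinity"
    have "app (ad (vf_cb_op (W n)) (vf_cb_op (W k))) f x = commutator (W n) (W k) f x"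
      by (simp add: ad_def app_vf_cb_op W f Cb_infinity_vf_op commutator_def)
    then show "app (ad (vf_cb_op (W n)) (vf_cb_op (W k))) f x = app (\<alpha> n k *\<^sub>R vf_cb_op (W (n + k))) f x"
      by (simp add: \<alpha> Cb_infinity_smooth app_vf_cb_op W f)
  qed
  then show ?thesis using that by blast
qed

section \<open>Flows\<close>

definition solves :: "('a::real_normed_vector \<Rightarrow> 'a) \<Rightarrow> 'a \<Rightarrow> (real \<Rightarrow> 'a) \<Rightarrow> bool"
  where "solves V x u \<longleftrightarrow> u 0 = x \<and>
    (\<forall>s\<in>{0..1}. (u has_vector_derivative V (u s)) (at s within {0..1}))"

text \<open>Gronwall's inequality for the squared distance, which is differentiable where the norm
  need not be. Adding \<epsilon>^2 absorbs the inhomogeneous part through 2 n \<epsilon> <= n^2 +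
  \<epsilon>^2 and yields h' <= (2 L + 1) h. With \<epsilon> = 0 this gives uniqueness, in general
  continuous dependence on field and starting point.\<close>

lemma solves_gronwall:
  fixes V V' :: "'a::real_inner \<Rightarrow> 'a"
  assumes u: "solves V x u" and v: "solves V' y v"
    and "L \<ge> 0" and L: "\<And>p q. norm (V p - V q) \<le> L * norm (p - q)"
    and eps: "\<And>p. norm (V p - V' p) \<le> \<epsilon>"
  shows "(norm (u 1 - v 1))\<^sup>2 \<le> ((norm (x - y))\<^sup>2 + \<epsilon>\<^sup>2) * exp (2 * L + 1)"
proof -
  define h where "h s = (u s - v s) \<bullet> (u s - v s) + \<epsilon>\<^sup>2" for s
  define c where "c = 2 * L + 1"
  have "\<epsilon> \<ge> 0"
    using order_trans[OF norm_ge_zero eps] .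
  have du: "(u has_vector_derivative V (u s)) (at s within {0..1})"
    and dv: "(v has_vector_derivative V' (v s)) (at s within {0..1})" if "s \<in> {0..1}" for s
    using u v that by (auto simp: solves_def)
  have cont: "continuous_on {0..1} u" "continuous_on {0..1} v"
    by (auto intro!: continuous_on_vector_derivative du dv simp del: atLeastAtMost_iff)
  have dh: "(h has_real_derivative 2 * ((u s - v s) \<bullet> (V (u s) - V' (v s)))) (at s)"
    if "0 < s" "s < 1" for s
  proof -
    have d: "((\<lambda>s. u s - v s) has_vector_derivative V (u s) - V' (v s)) (at s)"
      using has_vector_derivative_diff[OF du dv, of s] that by (simp add: at_within_Icc_at)
    show ?thesis
      unfolding has_real_derivative_iff_has_vector_derivative h_def
      using has_vector_derivative_add[OF
          bounded_bilinear.has_vector_derivative[OF bounded_bilinear_inner d d] has_vector_derivative_const[of "\<epsilon>\<^sup>2"]]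
      by (simp add: inner_commute)
  qed
  have h_le: "2 * ((u s - v s) \<bullet> (V (u s) - V' (v s))) \<le> c * h s" for s
  proof -
    let ?n = "norm (u s - v s)"
    have "norm (V (u s) - V' (v s)) \<le> L * ?n + \<epsilon>"
      using norm_triangle_ineq[of "V (u s) - V (v s)" "V (v s) - V' (v s)"] L[of "u s" "v s"] eps[of "v s"]
      by simp
    then have "(u s - v s) \<bullet> (V (u s) - V' (v s)) \<le> ?n * (L * ?n + \<epsilon>)"
      by (meson norm_cauchy_schwarz mult_left_mono norm_ge_zero order_trans)
    moreover have "2 * (?n * \<epsilon>) \<le> ?n\<^sup>2 + \<epsilon>\<^sup>2"
      using sum_squares_bound[of ?n \<epsilon>] by (simp add: mult.assoc)
    moreover have "c * h s = 2 * L * ?n\<^sup>2 + 2 * L * \<epsilon>\<^sup>2 + ?n\<^sup>2 + \<epsilon>\<^sup>2"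
      by (simp add: c_def h_def dot_square_norm algebra_simps)
    moreover have "0 \<le> 2 * L * \<epsilon>\<^sup>2"
      using \<open>L \<ge> 0\<close> by simp
    moreover have "?n * (L * ?n + \<epsilon>) = L * ?n\<^sup>2 + ?n * \<epsilon>"
      by (simp add: power2_eq_square algebra_simps)
    ultimately show ?thesis by linarith
  qed
  have "h 1 * exp (- c * 1) \<le> h 0 * exp (- c * 0)"
  proof (rule DERIV_nonpos_imp_decreasing_open[where f = "\<lambda>s. h s * exp (- c * s)"])
    show "continuous_on {0..1} (\<lambda>s. h s * exp (- c * s))"
      unfolding h_def by (intro continuous_intros cont)
    fix s :: real assume s: "0 < s" "s < 1"
    let ?d = "(2 * ((u s - v s) \<bullet> (V (u s) - V' (v s))) - c * h s) * exp (- c * s)"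
    have "((\<lambda>s. h s * exp (- c * s)) has_real_derivative ?d) (at s)"
      by (rule derivative_eq_intros refl dh s)+ (simp add: algebra_simps)
    moreover have "?d \<le> 0"
      using h_le[of s] by (intro mult_nonpos_nonneg) auto
    ultimately show "\<exists>d. ((\<lambda>s. h s * exp (- c * s)) has_real_derivative d) (at s) \<and> d \<le> 0"
      by blast
  qed simp
  then have "h 1 \<le> h 0 * exp c"
    by (simp add: exp_minus field_simps)
  moreover have "(norm (u 1 - v 1))\<^sup>2 \<le> h 1"
    by (simp add: h_def dot_square_norm)
  moreover have "h 0 = (norm (x - y))\<^sup>2 + \<epsilon>\<^sup>2"
    using u v by (simp add: h_def dot_square_norm solves_def)
  ultimately show ?thesis by (simp add: c_def)
qed

text \<open>Picard iteration. The iterates converge uniformly as sums of their increments, and their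
  derivatives converge uniformly because V is Lipschitz; hence the limit may be differentiated
  termwise.\<close>

lemma solves_exists:
  fixes V :: "'a::banach \<Rightarrow> 'a"
  assumes L: "\<And>p q. norm (V p - V q) \<le> L * norm (p - q)" and "L \<ge> 0"
  obtains u where "solves V x u"
proof -
  define U :: "nat \<Rightarrow> real \<Rightarrow> 'a" where "U = rec_nat (\<lambda>_. x) (\<lambda>_ u t. x + integral {0..t} (\<lambda>s. V (u s)))"
  have U_0: "U 0 = (\<lambda>_. x)" and U_Suc: "U (Suc n) = (\<lambda>t. x + integral {0..t} (\<lambda>s. V (U n s)))" for n
    by (simp_all add: U_def)
  have contV: "continuous_on S V" for S
    using L \<open>L \<ge> 0\<close> by (intro lipschitz_on_continuous_on[of L] lipschitz_onI) (simp_all add: dist_norm)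
  have contVU: "continuous_on {0..1} (\<lambda>s. V (U n s))" if "continuous_on {0..1} (U n)" for n
    using continuous_on_compose[OF that contV] by (simp add: o_def)
  have dU_aux: "(U (Suc n) has_vector_derivative V (U n t)) (at t within {0..1})"
    if "continuous_on {0..1} (U n)" "t \<in> {0..1}" for n t
    using has_vector_derivative_add[OF has_vector_derivative_const
        integral_has_vector_derivative[OF contVU[OF that(1)] that(2)], of x] by (simp add: U_Suc)
  have contU: "continuous_on {0..1} (U n)" for n
  proof (induction n)
    case (Suc n)
    show ?case
      by (rule continuous_on_vector_derivative) (rule dU_aux[OF Suc])
  qed (simp add: U_0)
  note dU = dU_aux[OF contU]
  define B where "B = norm (V x)"
  \<comment> \<open>The weight \<open>exp (2 * L * t)\<close> turns Picard iteration into a contraction with factor \<open>1/2\<close>.\<close>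
  have step: "norm (U (Suc n) t - U n t) \<le> B * (1/2) ^ n * exp (2 * L * t)" if "t \<in> {0..1}" for n t
    using that
  proof (induction n arbitrary: t)
    case 0
    have "norm (U (Suc 0) t - U 0 t) = t * B"
      using 0 by (simp add: U_Suc U_0 B_def)
    also have "\<dots> \<le> exp (2 * L * t) * B"
      using 0 \<open>L \<ge> 0\<close> by (intro mult_right_mono order_trans[of t 1 "exp (2 * L * t)"]) (auto simp: B_def)
    finally show ?case by (simp add: mult.commute)
  next
    case (Suc n)
    define F where "F s = U (Suc (Suc n)) s - U (Suc n) s" for s
    define \<phi> where "\<phi> s = B * (1/2) ^ Suc n * exp (2 * L * s)" for s
    have F0: "F 0 = 0" by (simp add: F_def U_Suc)
    have "norm (F t) \<le> \<phi> t"
    proof (cases "t = 0")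
      case False
      have "norm (F t - F 0) \<le> \<phi> t - \<phi> 0"
      proof (rule differentiable_bound_general[where f' = "\<lambda>s. V (U (Suc n) s) - V (U n s)"
            and \<phi>' = "\<lambda>s. L * (B * (1/2) ^ n * exp (2 * L * s))"])
        show "0 < t" using Suc.prems False by simp
        show "continuous_on {0..t} F"
          unfolding F_def by (intro continuous_on_diff continuous_on_subset[OF contU]) (use Suc.prems in auto)
        show "continuous_on {0..t} \<phi>"
          unfolding \<phi>_def by (intro continuous_intros)
        fix s assume s: "0 < s" "s < t"
        then have s': "s \<in> {0..1}" "0 < s" "s < 1" using Suc.prems by auto
        show "(F has_vector_derivative V (U (Suc n) s) - V (U n s)) (at s)"
          using has_vector_derivative_diff[OF dU dU, OF s'(1) s'(1), of "Suc n" n] s'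
          by (simp add: at_within_Icc_at F_def[abs_def])
        show "(\<phi> has_vector_derivative L * (B * (1/2) ^ n * exp (2 * L * s))) (at s)"
          unfolding has_real_derivative_iff_has_vector_derivative[symmetric] \<phi>_def
          by (rule derivative_eq_intros refl)+ simp
        show "norm (V (U (Suc n) s) - V (U n s)) \<le> L * (B * (1/2) ^ n * exp (2 * L * s))"
          using order_trans[OF L mult_left_mono[OF Suc.IH[OF s'(1)] \<open>L \<ge> 0\<close>]] .
      qed
      moreover have "\<phi> 0 \<ge> 0" by (simp add: \<phi>_def B_def)
      ultimately show ?thesis by (simp add: F0)
    qed (simp add: F0 \<phi>_def B_def)
    then show ?case by (simp add: F_def \<phi>_def)
  qed
  have step': "norm (U (Suc n) t - U n t) \<le> B * exp (2 * L) * (1/2) ^ n" if "t \<in> {0..1}" for n t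
  proof -
    have "2 * L * t \<le> 2 * L * 1"
      using that \<open>L \<ge> 0\<close> by (intro mult_left_mono) auto
    then have "B * (1/2) ^ n * exp (2 * L * t) \<le> B * (1/2) ^ n * exp (2 * L)"
      by (intro mult_left_mono) (auto simp: B_def)
    then show ?thesis
      using order_trans[OF step[OF that]] by (simp add: mult_ac)
  qed
  define u where "u t = x + (\<Sum>i. U (Suc i) t - U i t)" for t
  have "uniform_limit {0..1} (\<lambda>n t. \<Sum>i<n. U (Suc i) t - U i t) (\<lambda>t. \<Sum>i. U (Suc i) t - U i t) sequentially"
  proof (rule Weierstrass_m_test)
    show "summable (\<lambda>n. B * exp (2 * L) * (1/2) ^ n)"
      by (intro summable_mult summable_geometric) simp
  qed (rule step')
  then have "uniform_limit {0..1} (\<lambda>n t. x + (\<Sum>i<n. U (Suc i) t - U i t)) u sequentially"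
    unfolding u_def by (intro uniform_limit_intros)
  moreover have "x + (\<Sum>i<n. U (Suc i) t - U i t) = U n t" for n t
    using sum_lessThan_telescope[of "\<lambda>i. U i t" n] by (simp add: U_0)
  ultimately have lim: "uniform_limit {0..1} U u sequentially"
    by (simp add: eta_contract_eq)
  have conv: "\<exists>g. \<forall>t\<in>{0..1}. (\<lambda>n. U (Suc n) t) \<longlonglongrightarrow> g t \<and>
      (g has_derivative (\<lambda>h. h *\<^sub>R V (u t))) (at t within {0..1})"
  proof (rule has_derivative_sequence[where ?x0.0 = 0 and l = x and f' = "\<lambda>n t h. h *\<^sub>R V (U n t)"])
    show "(U (Suc n) has_derivative (\<lambda>h. h *\<^sub>R V (U n t))) (at t within {0..1})" if "t \<in> {0..1}" for n t
      using dU[OF that] by (simp add: has_vector_derivative_def)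
    show "(\<lambda>n. U (Suc n) 0) \<longlonglongrightarrow> x"
      by (simp add: U_Suc)
    fix e :: real assume "e > 0"
    \<comment> \<open>L + 1 takes the place of L, which may be 0.\<close>
    then have "e / (L + 1) > 0" using \<open>L \<ge> 0\<close> by simp
    from uniform_limitD[OF lim this]
    show "\<forall>\<^sub>F n in sequentially. \<forall>t\<in>{0..1}. \<forall>h. norm (h *\<^sub>R V (U n t) - h *\<^sub>R V (u t)) \<le> e * norm h"
    proof eventually_elim
      case (elim n)
      have "norm (V (U n t) - V (u t)) \<le> e" if "t \<in> {0..1}" for t
      proof -
        have "norm (U n t - u t) \<le> e / (L + 1)"
          using elim that by (auto simp: dist_norm less_imp_le)
        then have "L * norm (U n t - u t) \<le> (L + 1) * (e / (L + 1))"
          using \<open>L \<ge> 0\<close> by (intro mult_mono) auto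
        then show ?thesis
          using order_trans[OF L] \<open>L \<ge> 0\<close> by simp
      qed
      then show ?case
        by (auto simp: scaleR_diff_right[symmetric] mult.commute[of e] intro!: mult_left_mono)
    qed
  qed auto
  then obtain g where g: "\<And>t. t \<in> {0..1} \<Longrightarrow> (\<lambda>n. U (Suc n) t) \<longlonglongrightarrow> g t"
    "\<And>t. t \<in> {0..1} \<Longrightarrow> (g has_derivative (\<lambda>h. h *\<^sub>R V (u t))) (at t within {0..1})"
    by blast
  have gu: "g t = u t" if "t \<in> {0..1}" for t
    using LIMSEQ_unique[OF g(1)[OF that] LIMSEQ_Suc[OF tendsto_uniform_limitI[OF lim that]]] .
  have "solves V x g"
    unfolding solves_def
  proof (intro conjI ballI)
    have "(\<lambda>n. U (Suc n) 0) \<longlonglongrightarrow> x"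
      by (simp add: U_Suc)
    then show "g 0 = x"
      using LIMSEQ_unique g(1)[of 0] by auto
    show "(g has_vector_derivative V (g s)) (at s within {0..1})" if "s \<in> {0..1}" for s
      using g(2)[OF that] by (simp add: has_vector_derivative_def gu[OF that])
  qed
  then show ?thesis by (rule that)
qed

text \<open>Justifies the definite description in \<open>vf_exp\<close>: existence comes from
  \<open>solves_exists\<close>, uniqueness from \<open>solves_gronwall\<close> with \<epsilon> = 0
  and equal starting points.\<close>

lemma vf_exp_solves:
  fixes V :: "'n::finite vfield"
  assumes "V \<in> Cb_infinity"
  obtains u where "solves V x u" "u 1 = vf_exp V x"
proof -
  obtain L where L: "L \<ge> 0" "\<And>p q. norm (V p - V q) \<le> L * norm (p - q)"
    using Cb_infinity_lipschitz[OF assms] by metis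
  obtain u where u: "solves V x u"
    using solves_exists[of V L x] L by metis
  have "vf_exp V x = u 1"
    unfolding vf_exp_def
  proof (rule the_equality)
    show "\<exists>v. v 0 = x \<and> v 1 = u 1 \<and> (\<forall>s\<in>{0..1}. (v has_vector_derivative V (v s)) (at s within {0..1}))"
      using u by (auto simp: solves_def)
    fix y assume "\<exists>v. v 0 = x \<and> v 1 = y \<and> (\<forall>s\<in>{0..1}. (v has_vector_derivative V (v s)) (at s within {0..1}))"
    then obtain v where v: "solves V x v" "v 1 = y"
      by (auto simp: solves_def)
    have "(norm (v 1 - u 1))\<^sup>2 \<le> ((norm (x - x))\<^sup>2 + 0\<^sup>2) * exp (2 * L + 1)"
      by (rule solves_gronwall[OF v(1) u L]) simp
    then show "y = u 1" by (simp add: v)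
  qed
  then show ?thesis using u that by metis
qed

lemma vf_exp_diff_le:
  fixes V V' :: "'n::finite vfield"
  assumes "V \<in> Cb_infinity" "V' \<in> Cb_infinity"
    and "L \<ge> 0" "\<And>p q. norm (V p - V q) \<le> L * norm (p - q)" and "\<And>p. norm (V p - V' p) \<le> \<epsilon>"
  shows "(norm (vf_exp V x - vf_exp V' y))\<^sup>2 \<le> ((norm (x - y))\<^sup>2 + \<epsilon>\<^sup>2) * exp (2 * L + 1)"
  using vf_exp_solves[OF assms(1), of x] vf_exp_solves[OF assms(2), of y] solves_gronwall[OF _ _ assms(3-5)]
  by metis

text \<open>Along the flow the time derivative of g(u(t)) is (V g)(u(t)), so the k-th derivative of
  f(u(t)) is (V^k f)(u(t)) and the Taylor polynomial at 0 is the truncated exponential series. The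
  kernel (1 - t)^m / m! of the integral remainder is at most 1.\<close>

lemma vf_exp_taylor:
  fixes V :: "'n::finite vfield" and f :: "real^'n \<Rightarrow> real"
  assumes V: "V \<in> Cb_infinity" and f: "f \<in> Cb_infinity"
    and B: "\<And>y. \<bar>app (vf_cb_op V ^ Suc m) f y\<bar> \<le> B"
  shows "\<bar>f (vf_exp V x) - app (texp m (vf_cb_op V)) f x\<bar> \<le> B"
proof -
  obtain u where u: "solves V x u" "u 1 = vf_exp V x"
    using vf_exp_solves[OF V] by metis
  define D where "D k t = app (vf_cb_op V ^ k) f (u t)" for k t
  have D0: "D 0 = (\<lambda>t. f (u t))"
    by (simp add: D_def[abs_def] app_one f)
  have dD: "(D k has_vector_derivative D (Suc k) t) (at t within {0..1})" if "0 \<le> t" "t \<le> 1" for k t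
  proof -
    define g where "g = app (vf_cb_op V ^ k) f"
    have g: "g \<in> Cb_infinity" by (simp add: g_def)
    have "((g \<circ> u) has_vector_derivative frechet_derivative g (at (u t)) (V (u t))) (at t within {0..1})"
    proof (rule vector_derivative_diff_chain_within)
      show "(u has_vector_derivative V (u t)) (at t within {0..1})"
        using u that by (simp add: solves_def)
      show "(g has_derivative frechet_derivative g (at (u t))) (at (u t) within u ` {0..1})"
        by (rule has_derivative_at_withinI[OF frechet_derivative_has[OF Cb_infinity_differentiable[OF g]]])
    qed
    moreover have "frechet_derivative g (at (u t)) (V (u t)) = D (Suc k) t"
      by (simp add: D_def g_def[symmetric] app_vf_cb_op V g vf_op_def
          frechet_derivative_partial[OF Cb_infinity_differentiable[OF g]])
    ultimately show ?thesis by (simp add: D_def[abs_def] g_def o_def)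
  qed
  let ?I = "\<lambda>t. ((1 - t) ^ (Suc m - 1) / fact (Suc m - 1)) *\<^sub>R D (Suc m) t"
  have int: "(?I has_integral D 0 1 - (\<Sum>i<Suc m. ((1 - 0) ^ i / fact i) *\<^sub>R D i 0)) (cbox 0 1)"
    unfolding box_real by (rule Taylor_has_integral[where f = "D 0"]) (auto intro: dD)
  have B0: "0 \<le> B"
    using order_trans[OF abs_ge_zero B] .
  have "norm (D 0 1 - (\<Sum>i<Suc m. ((1 - 0) ^ i / fact i) *\<^sub>R D i 0)) \<le> B * measure lborel (cbox 0 (1::real))"
  proof (rule has_integral_bound[OF B0 int])
    fix t :: real assume "t \<in> cbox 0 1"
    then have t: "0 \<le> t" "t \<le> 1" by auto
    have "(1 - t) ^ m / fact m \<le> 1"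
      using t order_trans[OF power_le_one[of "1 - t" m] fact_ge_1[of m, where 'a = real]] by simp
    then have "\<bar>(1 - t) ^ m / fact m\<bar> * \<bar>D (Suc m) t\<bar> \<le> 1 * B"
      using t B[of "u t"] by (intro mult_mono) (auto simp: D_def)
    then show "norm (?I t) \<le> B"
      by (simp add: abs_mult)
  qed
  moreover have "(\<Sum>i<Suc m. ((1 - 0) ^ i / fact i) *\<^sub>R D i 0) = app (texp m (vf_cb_op V)) f x"
    using u by (simp add: texp_def app_sum D_def solves_def lessThan_Suc_atMost del: sum.lessThan_Suc)
  ultimately show ?thesis
    using u by (simp add: D0)
qed

section \<open>Combinations of fields and continuity of the flow in their coefficients\<close>

lemma Cb_infinity_vsum:
  fixes W :: "nat \<Rightarrow> 'n::finite vfield"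
  assumes "\<And>k. W k \<in> Cb_infinity"
  shows "(\<lambda>x. \<Sum>k\<le>(n::nat). c k *\<^sub>R W k x) \<in> Cb_infinity"
proof (induction n)
  case 0
  show ?case using Cb_infinity_lincomb[OF assms Cb_infinity_const, of "c 0" 0 0] by simp
next
  case (Suc n)
  show ?case using Cb_infinity_lincomb[OF assms Suc, of "c (Suc n)" "Suc n"] by (simp add: add.commute)
qed

lemma vf_cb_op_sum:
  fixes W :: "nat \<Rightarrow> 'n::finite vfield"
  assumes "\<And>k. W k \<in> Cb_infinity"
  shows "vf_cb_op (\<lambda>x. \<Sum>k\<le>(n::nat). c k *\<^sub>R W k x) = (\<Sum>k\<le>n. c k *\<^sub>R vf_cb_op (W k))"
proof (intro app_eqI ext)
  fix f :: "real^'n \<Rightarrow> real" and x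
  assume f: "f \<in> Cb_infinity"
  have "vf_op (\<lambda>x. \<Sum>k\<le>n. c k *\<^sub>R W k x) f x = (\<Sum>j\<in>UNIV. \<Sum>k\<le>n. c k * (W k x $ j * partial_deriv j f x))"
    by (simp add: vf_op_def sum_distrib_right mult.assoc)
  also have "\<dots> = (\<Sum>k\<le>n. c k * vf_op (W k) f x)"
    by (subst sum.swap) (simp add: vf_op_def sum_distrib_left)
  finally show "app (vf_cb_op (\<lambda>x. \<Sum>k\<le>n. c k *\<^sub>R W k x)) f x = app (\<Sum>k\<le>n. c k *\<^sub>R vf_cb_op (W k)) f x"
    by (simp add: app_vf_cb_op Cb_infinity_vsum assms f app_sum)
qed

text \<open>Serves the measurability of flows with random coefficients and random starting point.
  The Lipschitz constant is that of the field at the limit point \<open>p0\<close>; the nearby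
  fields enter only through their uniform distance from it, which the differences of the
  coefficients control.\<close>

lemma continuous_vf_exp:
  fixes W :: "nat \<Rightarrow> 'n::finite vfield"
  assumes W: "\<And>k. W k \<in> Cb_infinity"
  shows "continuous_on UNIV (\<lambda>p::(nat \<Rightarrow> real) \<times> (real^'n). vf_exp (\<lambda>x. \<Sum>k\<le>n. fst p k *\<^sub>R W k x) (snd p))"
    (is "continuous_on UNIV ?G")
proof (rule continuous_at_imp_continuous_on, rule ballI)
  fix p0 :: "(nat \<Rightarrow> real) \<times> (real^'n)"
  obtain c y where p0: "p0 = (c, y)" by force
  have "\<forall>k. \<exists>B\<ge>0. \<forall>x. norm (W k x) \<le> B"
    using Cb_infinity_bounded[OF W] by (simp add: bounded_range_iff)
  then obtain B where B: "\<And>k x. norm (W k x) \<le> B k"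
    by metis
  define V where "V x = (\<Sum>k\<le>n. c k *\<^sub>R W k x)" for x
  have V: "V \<in> Cb_infinity"
    unfolding V_def by (rule Cb_infinity_vsum[OF W])
  obtain L where L: "L \<ge> 0" "\<And>p q. norm (V p - V q) \<le> L * norm (p - q)"
    using Cb_infinity_lipschitz[OF V] by metis
  let ?r = "\<lambda>p. sqrt (((norm (y - snd p))\<^sup>2 + (\<Sum>k\<le>n. \<bar>c k - fst p k\<bar> * B k)\<^sup>2) * exp (2 * L + 1))"
  have le: "norm (?G p - ?G p0) \<le> ?r p" for p
  proof -
    have "(norm (?G p0 - ?G p))\<^sup>2 \<le> ((norm (y - snd p))\<^sup>2 + (\<Sum>k\<le>n. \<bar>c k - fst p k\<bar> * B k)\<^sup>2) * exp (2 * L + 1)"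
      unfolding p0 fst_conv snd_conv V_def[symmetric]
    proof (rule vf_exp_diff_le[OF V Cb_infinity_vsum[OF W] L])
      fix q
      have "V q - (\<Sum>k\<le>n. fst p k *\<^sub>R W k q) = (\<Sum>k\<le>n. (c k - fst p k) *\<^sub>R W k q)"
        by (simp add: V_def sum_subtractf scaleR_diff_left)
      also have "norm \<dots> \<le> (\<Sum>k\<le>n. \<bar>c k - fst p k\<bar> * B k)"
        by (rule sum_norm_le) (auto intro: mult_left_mono B)
      finally show "norm (V q - (\<Sum>k\<le>n. fst p k *\<^sub>R W k q)) \<le> (\<Sum>k\<le>n. \<bar>c k - fst p k\<bar> * B k)" .
    qed
    then show ?thesis
      by (simp add: real_le_rsqrt norm_minus_commute)
  qed
  have coord: "((\<lambda>p. fst p k) \<longlongrightarrow> c k) (at p0)" for k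
  proof -
    have "isCont (\<lambda>c::nat \<Rightarrow> real. c k) c"
      using continuous_on_product_coordinates[of k] continuous_on_eq_continuous_at[OF open_UNIV] by blast
    from isCont_tendsto_compose[OF this] show ?thesis
      using tendsto_fst[OF tendsto_ident_at, of p0 UNIV] by (simp add: p0)
  qed
  have "(?r \<longlongrightarrow> sqrt (((norm (y - y))\<^sup>2 + (\<Sum>k\<le>n. \<bar>c k - c k\<bar> * B k)\<^sup>2) * exp (2 * L + 1))) (at p0)"
    by (intro tendsto_intros coord) (use tendsto_snd[OF tendsto_ident_at, of p0 UNIV] in \<open>simp add: p0\<close>)
  then have "(?r \<longlongrightarrow> 0) (at p0)"
    by simp
  then have "((\<lambda>p. ?G p - ?G p0) \<longlongrightarrow> 0) (at p0)"
    by (rule Lim_null_comparison[rotated]) (simp add: le)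
  then show "isCont ?G p0"
    by (simp add: isCont_def LIM_zero_iff)
qed

section \<open>Random operators that are polynomial in the parameter\<close>

lemma bilinear_mult: "bilinear ((*) :: 'a \<Rightarrow> 'a \<Rightarrow> 'a::real_algebra_1)"
  by (auto simp: bilinear_def linear_iff algebra_simps)

text \<open>\<open>X\<close> is the polynomial \<open>T\<close>, viewed as a power series in its real argument.\<close>

definition represents :: "'w measure \<Rightarrow> (real \<Rightarrow> 'w \<Rightarrow> 'a::real_algebra_1) \<Rightarrow> ('w \<Rightarrow> 'a fps) \<Rightarrow> bool"
  where "represents M T X \<longleftrightarrow> (\<forall>i. (\<lambda>\<omega>. fps_nth (X \<omega>) i) \<in> rspan M UNIV) \<and>
    (\<exists>N. \<forall>\<omega>. (\<forall>i>N. fps_nth (X \<omega>) i = 0) \<and> (\<forall>l. T l \<omega> = (\<Sum>i\<le>N. l ^ i *\<^sub>R fps_nth (X \<omega>) i)))"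

lemma represents_coeff: "represents M T X \<Longrightarrow> (\<lambda>\<omega>. fps_nth (X \<omega>) i) \<in> rspan M UNIV"
  by (simp add: represents_def)

lemma representsE:
  assumes "represents M T X"
  obtains N where "\<And>\<omega> i. i > N \<Longrightarrow> fps_nth (X \<omega>) i = 0"
    "\<And>l \<omega> N'. N \<le> N' \<Longrightarrow> T l \<omega> = (\<Sum>i\<le>N'. l ^ i *\<^sub>R fps_nth (X \<omega>) i)"
proof -
  obtain N where N: "\<And>\<omega> i. i > N \<Longrightarrow> fps_nth (X \<omega>) i = 0"
    "\<And>l \<omega>. T l \<omega> = (\<Sum>i\<le>N. l ^ i *\<^sub>R fps_nth (X \<omega>) i)"
    using assms unfolding represents_def by metis
  have "T l \<omega> = (\<Sum>i\<le>N'. l ^ i *\<^sub>R fps_nth (X \<omega>) i)" if "N \<le> N'" for l \<omega> N'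
    unfolding N(2) using that by (intro sum.mono_neutral_left) (auto simp: N(1))
  then show ?thesis using N(1) that by blast
qed

lemma representsI:
  assumes "\<And>i. (\<lambda>\<omega>. fps_nth (X \<omega>) i) \<in> rspan M UNIV" "\<And>\<omega> i. i > N \<Longrightarrow> fps_nth (X \<omega>) i = 0"
    "\<And>l \<omega>. T l \<omega> = (\<Sum>i\<le>N. l ^ i *\<^sub>R fps_nth (X \<omega>) i)"
  shows "represents M T X"
  unfolding represents_def using assms by blast

lemma represents_add:
  assumes "represents M S X" "represents M T Y"
  shows "represents M (\<lambda>l \<omega>. S l \<omega> + T l \<omega>) (\<lambda>\<omega>. X \<omega> + Y \<omega>)"
proof -
  obtain N1 where N1: "\<And>\<omega> i. i > N1 \<Longrightarrow> fps_nth (X \<omega>) i = 0"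
    "\<And>l \<omega> N'. N1 \<le> N' \<Longrightarrow> S l \<omega> = (\<Sum>i\<le>N'. l ^ i *\<^sub>R fps_nth (X \<omega>) i)"
    using representsE[OF assms(1)] by metis
  obtain N2 where N2: "\<And>\<omega> i. i > N2 \<Longrightarrow> fps_nth (Y \<omega>) i = 0"
    "\<And>l \<omega> N'. N2 \<le> N' \<Longrightarrow> T l \<omega> = (\<Sum>i\<le>N'. l ^ i *\<^sub>R fps_nth (Y \<omega>) i)"
    using representsE[OF assms(2)] by metis
  show ?thesis
    by (rule representsI[where N = "max N1 N2"])
      (auto simp: N1 N2(1) N1(2)[of "max N1 N2"] N2(2)[of "max N1 N2"] sum.distrib scaleR_add_right
        intro: rspan_add represents_coeff[OF assms(1)] represents_coeff[OF assms(2)])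
qed

context prob_space
begin

lemma rspan_mult:
  fixes S T :: "'a \<Rightarrow> 'b::real_algebra_1"
  assumes "S \<in> rspan M UNIV" "T \<in> rspan M UNIV"
  shows "(\<lambda>\<omega>. S \<omega> * T \<omega>) \<in> rspan M UNIV"
  by (rule rspan_bilinear[OF bilinear_mult assms]) (auto intro: rspan_const)

lemma represents_mult:
  assumes "represents M S X" "represents M T Y"
  shows "represents M (\<lambda>l \<omega>. S l \<omega> * T l \<omega>) (\<lambda>\<omega>. X \<omega> * Y \<omega>)"
proof -
  obtain N1 where N1: "\<And>\<omega> i. i > N1 \<Longrightarrow> fps_nth (X \<omega>) i = 0"
    "\<And>l \<omega> N'. N1 \<le> N' \<Longrightarrow> S l \<omega> = (\<Sum>i\<le>N'. l ^ i *\<^sub>R fps_nth (X \<omega>) i)"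
    using representsE[OF assms(1)] by metis
  obtain N2 where N2: "\<And>\<omega> i. i > N2 \<Longrightarrow> fps_nth (Y \<omega>) i = 0"
    "\<And>l \<omega> N'. N2 \<le> N' \<Longrightarrow> T l \<omega> = (\<Sum>i\<le>N'. l ^ i *\<^sub>R fps_nth (Y \<omega>) i)"
    using representsE[OF assms(2)] by metis
  show ?thesis
  proof (rule representsI[where N = "N1 + N2"])
    show "(\<lambda>\<omega>. fps_nth (X \<omega> * Y \<omega>) i) \<in> rspan M UNIV" for i
      unfolding fps_mult_nth
      by (intro rspan_sum rspan_mult represents_coeff[OF assms(1)] represents_coeff[OF assms(2)])
    show "fps_nth (X \<omega> * Y \<omega>) i = 0" if "i > N1 + N2" for \<omega> i
      unfolding fps_mult_nth
    proof (rule sum.neutral, rule ballI)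
      fix j assume "j \<in> {0..i}"
      then have "j > N1 \<or> i - j > N2" using that by auto
      then show "fps_nth (X \<omega>) j * fps_nth (Y \<omega>) (i - j) = 0"
        by (auto simp: N1(1) N2(1))
    qed
    fix l \<omega>
    let ?a = "\<lambda>i. l ^ i *\<^sub>R fps_nth (X \<omega>) i" and ?b = "\<lambda>j. l ^ j *\<^sub>R fps_nth (Y \<omega>) j"
    have "S l \<omega> * T l \<omega> = (\<Sum>(i,j)\<in>{..N1} \<times> {..N2}. ?a i * ?b j)"
      unfolding N1(2)[OF order_refl] N2(2)[OF order_refl] by (simp add: sum_product sum.cartesian_product)
    \<comment> \<open>The rectangle of indices lies in this triangle, and the added terms vanish, as
      one of the indices exceeds its degree bound.\<close>
    also have "\<dots> = (\<Sum>(i,j)\<in>{(i,j). i + j \<le> N1 + N2}. ?a i * ?b j)"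
    proof (rule sum.mono_neutral_left)
      show "finite {(i,j). i + j \<le> N1 + N2}"
        by (rule finite_subset[of _ "{..N1 + N2} \<times> {..N1 + N2}"]) auto
      show "\<forall>p\<in>{(i,j). i + j \<le> N1 + N2} - {..N1} \<times> {..N2}. (case p of (i,j) \<Rightarrow> ?a i * ?b j) = 0"
      proof
        fix p assume "p \<in> {(i,j). i + j \<le> N1 + N2} - {..N1} \<times> {..N2}"
        then have "fst p > N1 \<or> snd p > N2" by auto
        then show "(case p of (i,j) \<Rightarrow> ?a i * ?b j) = 0"
          by (auto simp: case_prod_unfold N1(1) N2(1))
      qed
    qed auto
    also have "\<dots> = (\<Sum>k\<le>N1 + N2. \<Sum>i\<le>k. ?a i * ?b (k - i))"
      by (rule sum.triangle_reindex_eq)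
    also have "\<dots> = (\<Sum>k\<le>N1 + N2. l ^ k *\<^sub>R fps_nth (X \<omega> * Y \<omega>) k)"
    proof (rule sum.cong[OF refl])
      fix k
      have "?a i * ?b (k - i) = l ^ k *\<^sub>R (fps_nth (X \<omega>) i * fps_nth (Y \<omega>) (k - i))" if "i \<le> k" for i
        using that by (simp add: power_add[symmetric])
      then have "(\<Sum>i\<le>k. ?a i * ?b (k - i)) = (\<Sum>i\<le>k. l ^ k *\<^sub>R (fps_nth (X \<omega>) i * fps_nth (Y \<omega>) (k - i)))"
        by (intro sum.cong) (simp_all only: atMost_iff)
      then show "(\<Sum>i\<le>k. ?a i * ?b (k - i)) = l ^ k *\<^sub>R fps_nth (X \<omega> * Y \<omega>) k"
        by (simp only: fps_mult_nth atLeast0AtMost scaleR_sum_right)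
    qed
    finally show "S l \<omega> * T l \<omega> = (\<Sum>k\<le>N1 + N2. l ^ k *\<^sub>R fps_nth (X \<omega> * Y \<omega>) k)" .
  qed
qed

lemma represents_zero: "represents M (\<lambda>_ _. 0) (\<lambda>_. 0)"
  by (rule representsI[where N = 0]) (auto intro: rspan_zero)

lemma represents_one: "represents M (\<lambda>_ _. 1) (\<lambda>_. 1)"
  by (rule representsI[where N = 0]) (auto intro: rspan_zero rspan_const)

lemma represents_scaleR:
  assumes "represents M T X"
  shows "represents M (\<lambda>l \<omega>. c *\<^sub>R T l \<omega>) (\<lambda>\<omega>. c *\<^sub>R X \<omega>)"
proof -
  obtain N where N: "\<And>\<omega> i. i > N \<Longrightarrow> fps_nth (X \<omega>) i = 0"
    "\<And>l \<omega> N'. N \<le> N' \<Longrightarrow> T l \<omega> = (\<Sum>i\<le>N'. l ^ i *\<^sub>R fps_nth (X \<omega>) i)"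
    using representsE[OF assms] by metis
  show ?thesis
    by (rule representsI[where N = N])
      (auto simp: N(1) N(2)[of N] scaleR_sum_right mult.commute intro: rspan_cscaleR represents_coeff[OF assms])
qed

lemma represents_sum:
  "(\<And>a. a \<in> A \<Longrightarrow> represents M (T a) (X a)) \<Longrightarrow>
    represents M (\<lambda>l \<omega>. \<Sum>a\<in>A. T a l \<omega>) (\<lambda>\<omega>. \<Sum>a\<in>A. X a \<omega>)"
  by (induction A rule: infinite_finite_induct) (auto intro: represents_zero represents_add)

lemma represents_power:
  "represents M T X \<Longrightarrow> represents M (\<lambda>l \<omega>. T l \<omega> ^ k) (\<lambda>\<omega>. X \<omega> ^ k)"
  by (induction k) (auto intro: represents_one represents_mult)

lemma represents_texp:
  "represents M T X \<Longrightarrow> represents M (\<lambda>l \<omega>. texp m (T l \<omega>)) (\<lambda>\<omega>. texp m (X \<omega>))"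
  unfolding texp_def by (intro represents_sum represents_scaleR represents_power)

lemma Rpoly_star_poly:
  assumes "Q \<in> Rpoly_star M"
  obtains N where "\<And>\<omega> i. i > N \<Longrightarrow> coeff (Q \<omega>) i = 0"
    "\<And>\<omega> l. poly (Q \<omega>) l = (\<Sum>i\<le>N. coeff (Q \<omega>) i * l ^ i)"
proof -
  obtain N where N: "\<And>\<omega> i. i = 0 \<or> i > N \<Longrightarrow> coeff (Q \<omega>) i = 0"
    using Rpoly_star_coeff[OF assms] by metis
  have "poly (Q \<omega>) l = (\<Sum>i\<le>N. coeff (Q \<omega>) i * l ^ i)" for l \<omega>
    unfolding poly_altdef
    by (rule sum.mono_neutral_left) (auto intro: degree_le N simp: coeff_eq_0)
  then show ?thesis using N that by blast
qed

lemma Rpoly_star_coeff_L: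
  assumes "Q \<in> Rpoly_star M"
  shows "(\<lambda>\<omega>. coeff (Q \<omega>) i) \<in> L_inf_minus M" "coeff (Q \<omega>) 0 = 0"
  using Rpoly_star_coeff[OF assms] by metis+

lemma represents_poly:
  assumes "Q \<in> Rpoly_star M"
  shows "represents M (\<lambda>l \<omega>. poly (Q \<omega>) l *\<^sub>R b) (\<lambda>\<omega>. poly_series (Q \<omega>) b)"
proof -
  obtain N where N: "\<And>\<omega> i. i > N \<Longrightarrow> coeff (Q \<omega>) i = 0"
    "\<And>\<omega> l. poly (Q \<omega>) l = (\<Sum>i\<le>N. coeff (Q \<omega>) i * l ^ i)"
    using Rpoly_star_poly[OF assms] by metis
  show ?thesis
    by (rule representsI[where N = N])
      (auto simp: N scaleR_sum_left mult.commute intro: rspan_base Rpoly_star_coeff_L[OF assms])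
qed

text \<open>One random variable with all moments serves every x, because each of the finitely many
  fixed operators maps \<open>f\<close> to a bounded function.\<close>

lemma rspan_app_bound:
  assumes "T \<in> rspan M UNIV" and f: "f \<in> Cb_infinity"
  shows "\<exists>R\<in>L_inf_minus M. \<forall>\<omega> x. \<bar>app (T \<omega>) f x\<bar> \<le> R \<omega>"
  using assms(1)
proof induction
  case rspan_zero
  show ?case by (rule bexI[of _ "\<lambda>_. 0"]) (auto intro: L_inf_minus_const)
next
  case (rspan_base Z b)
  obtain B where B: "\<And>x. norm (app b f x) \<le> B"
    using Cb_infinity_bounded[of "app b f"] by (auto simp: bounded_range_iff)
  have "(\<lambda>\<omega>. B * \<bar>Z \<omega>\<bar>) \<in> L_inf_minus M"
    by (intro L_inf_minus_cmult L_inf_minus_abs rspan_base)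
  moreover have "\<bar>app (Z \<omega> *\<^sub>R b) f x\<bar> \<le> B * \<bar>Z \<omega>\<bar>" for \<omega> x
    using mult_right_mono[OF B[of x], of "\<bar>Z \<omega>\<bar>"] by (simp add: abs_mult mult.commute)
  ultimately show ?case
    by (intro bexI[of _ "\<lambda>\<omega>. B * \<bar>Z \<omega>\<bar>"] allI)
next
  case (rspan_add S T)
  then obtain R1 R2 where R: "R1 \<in> L_inf_minus M" "R2 \<in> L_inf_minus M"
    "\<And>\<omega> x. \<bar>app (S \<omega>) f x\<bar> \<le> R1 \<omega>" "\<And>\<omega> x. \<bar>app (T \<omega>) f x\<bar> \<le> R2 \<omega>"
    by blast
  have "\<bar>app (S \<omega> + T \<omega>) f x\<bar> \<le> R1 \<omega> + R2 \<omega>" for \<omega> x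
    using R(3)[of \<omega> x] R(4)[of \<omega> x] unfolding app_add by linarith
  then show ?case
    by (intro bexI[of _ "\<lambda>\<omega>. R1 \<omega> + R2 \<omega>"] allI L_inf_minus_add R)
qed

text \<open>Turns a formal order into an estimate: for l in [0,1] the powers l^i with i >= k are at
  most l^k, and the lower coefficients vanish.\<close>

lemma represents_order_bound:
  assumes T: "represents M T X" and X0: "\<And>\<omega> i. i < k \<Longrightarrow> fps_nth (X \<omega>) i = 0" and f: "f \<in> Cb_infinity"
  shows "\<exists>R\<in>L_inf_minus M. \<forall>\<omega>. \<forall>l\<in>{0..1}. \<forall>x. \<bar>app (T l \<omega>) f x\<bar> \<le> l ^ k * R \<omega>"
proof -
  obtain N where N: "\<And>\<omega> i. i > N \<Longrightarrow> fps_nth (X \<omega>) i = 0"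
    "\<And>l \<omega> N'. N \<le> N' \<Longrightarrow> T l \<omega> = (\<Sum>i\<le>N'. l ^ i *\<^sub>R fps_nth (X \<omega>) i)"
    using representsE[OF T] by metis
  have "\<forall>i. \<exists>R\<in>L_inf_minus M. \<forall>\<omega> x. \<bar>app (fps_nth (X \<omega>) i) f x\<bar> \<le> R \<omega>"
    using rspan_app_bound[OF represents_coeff[OF T] f] by blast
  then obtain R where R: "\<And>i. R i \<in> L_inf_minus M" "\<And>i \<omega> x. \<bar>app (fps_nth (X \<omega>) i) f x\<bar> \<le> R i \<omega>"
    by metis
  show ?thesis
  proof (intro bexI[of _ "\<lambda>\<omega>. \<Sum>i\<le>N. R i \<omega>"] L_inf_minus_sum R(1) allI ballI)
    fix \<omega> l x assume l: "l \<in> {0..1::real}"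
    have "\<bar>l ^ i * app (fps_nth (X \<omega>) i) f x\<bar> \<le> l ^ k * R i \<omega>" for i
    proof (cases "i < k")
      case True
      then show ?thesis
        using l order_trans[OF abs_ge_zero R(2)] by (simp add: X0)
    next
      case False
      then have "l ^ i \<le> l ^ k"
        using l by (intro power_decreasing) auto
      then show ?thesis
        using l R(2) by (auto simp: abs_mult intro!: mult_mono)
    qed
    then show "\<bar>app (T l \<omega>) f x\<bar> \<le> l ^ k * (\<Sum>i\<le>N. R i \<omega>)"
      unfolding N(2)[OF order_refl] app_sum app_scaleR sum_distrib_left
      by (intro order_trans[OF sum_abs] sum_mono)
  qed
qed

lemma measurable_vf_exp:
  assumes W: "\<And>k. W k \<in> Cb_infinity" and Y: "Y \<in> borel_measurable M"
    and c: "\<And>k. k \<le> n \<Longrightarrow> (\<lambda>\<omega>. c \<omega> k) \<in> borel_measurable M"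
  shows "(\<lambda>\<omega>. vf_exp (\<lambda>x. \<Sum>k\<le>(n::nat). c \<omega> k *\<^sub>R W k x) (Y \<omega>)) \<in> borel_measurable M"
proof -
  \<comment> \<open>Measurability into \<open>nat \<Rightarrow> real\<close> with the product
    topology concerns all coordinates, while the hypothesis speaks of those up to n.\<close>
  define c' where "c' \<omega> k = (if k \<le> n then c \<omega> k else 0)" for \<omega> k
  have "(\<lambda>\<omega>. c' \<omega> k) \<in> borel_measurable M" for k
    unfolding c'_def using c by (cases "k \<le> n") auto
  then have "c' \<in> borel_measurable M"
    by (rule measurable_coordinatewise_then_product)
  then have "(\<lambda>\<omega>. (c' \<omega>, Y \<omega>)) \<in> borel_measurable M"
    using Y by (rule borel_measurable_Pair)
  from borel_measurable_continuous_on[OF continuous_vf_exp[of W n, OF W] this]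
  have "(\<lambda>\<omega>. vf_exp (\<lambda>x. \<Sum>k\<le>n. c' \<omega> k *\<^sub>R W k x) (Y \<omega>)) \<in> borel_measurable M"
    by (simp only: fst_conv snd_conv)
  moreover have "(\<Sum>k\<le>n. c' \<omega> k *\<^sub>R W k x) = (\<Sum>k\<le>n. c \<omega> k *\<^sub>R W k x)" for \<omega> x
    by (intro sum.cong) (simp_all add: c'_def)
  ultimately show ?thesis by (simp only:)
qed

section \<open>Taylor expansion of chains of exponentials\<close>

text \<open>What the expansion of a chain requires of each factor. Measurability is stated for a
  random starting point \<open>Y\<close>, since inside a chain a flow starts where the previous one
  ended.\<close>

definition admissible :: "('a, 'n::finite) rvf_poly \<Rightarrow> ('a \<Rightarrow> 'n cb_op fps) \<Rightarrow> bool"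
  where "admissible \<xi> X \<longleftrightarrow> represents M (\<lambda>l \<omega>. vf_cb_op (\<xi> \<omega> l)) X \<and>
    (\<forall>\<omega>. fps_nth (X \<omega>) 0 = 0) \<and> (\<forall>\<omega> l. \<xi> \<omega> l \<in> Cb_infinity) \<and>
    (\<forall>l. \<forall>Y\<in>borel_measurable M. (\<lambda>\<omega>. vf_exp (\<xi> \<omega> l) (Y \<omega>)) \<in> borel_measurable M)"

lemma admissible_sum:
  fixes W :: "nat \<Rightarrow> 'n::finite vfield"
  assumes Q: "\<And>k. k \<le> n \<Longrightarrow> Q k \<in> Rpoly_star M" and W: "\<And>k. W k \<in> Cb_infinity"
  shows "admissible (\<lambda>\<omega> l x. \<Sum>k\<le>n. rvf_term (Q k) (W k) \<omega> l x)
    (\<lambda>\<omega>. \<Sum>k\<le>n. poly_series (Q k \<omega>) (vf_cb_op (W k)))"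
  unfolding admissible_def rvf_term_def
proof (intro conjI allI ballI)
  show "represents M (\<lambda>l \<omega>. vf_cb_op (\<lambda>x. \<Sum>k\<le>n. poly (Q k \<omega>) l *\<^sub>R W k x))
      (\<lambda>\<omega>. \<Sum>k\<le>n. poly_series (Q k \<omega>) (vf_cb_op (W k)))"
    unfolding vf_cb_op_sum[OF W] by (intro represents_sum represents_poly Q) simp
  show "fps_nth (\<Sum>k\<le>n. poly_series (Q k \<omega>) (vf_cb_op (W k))) 0 = 0" for \<omega>
    by (simp add: fps_sum_nth Rpoly_star_coeff_L(2) Q)
  show "(\<lambda>x. \<Sum>k\<le>n. poly (Q k \<omega>) l *\<^sub>R W k x) \<in> Cb_infinity" for \<omega> l
    by (rule Cb_infinity_vsum[OF W])
  fix l and Y :: "'a \<Rightarrow> real^'n" assume "Y \<in> borel_measurable M"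
  then show "(\<lambda>\<omega>. vf_exp (\<lambda>x. \<Sum>k\<le>n. poly (Q k \<omega>) l *\<^sub>R W k x) (Y \<omega>)) \<in> borel_measurable M"
  proof (rule measurable_vf_exp[OF W])
    fix k assume k: "k \<le> n"
    obtain N where "\<And>\<omega> l. poly (Q k \<omega>) l = (\<Sum>i\<le>N. coeff (Q k \<omega>) i * l ^ i)"
      using Rpoly_star_poly[OF Q[OF k]] by metis
    moreover have "(\<lambda>\<omega>. coeff (Q k \<omega>) i) \<in> borel_measurable M" for i
      using Rpoly_star_coeff_L(1)[OF Q[OF k]] by (simp add: L_inf_minus_def)
    ultimately show "(\<lambda>\<omega>. poly (Q k \<omega>) l) \<in> borel_measurable M"
      by simp
  qed
qed

text \<open>The remainder in \<open>vf_exp_taylor\<close> is governed by the power m + 1 of the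
  operator, whose series starts at order m + 1 because \<open>X\<close> has no constant
  term.\<close>

lemma admissible_taylor:
  assumes \<xi>: "admissible \<xi> X" and f: "f \<in> Cb_infinity"
  shows "\<exists>R\<in>L_inf_minus M. \<forall>\<omega>. \<forall>l\<in>{0..1}. \<forall>x.
    \<bar>f (vf_exp (\<xi> \<omega> l) x) - app (texp m (vf_cb_op (\<xi> \<omega> l))) f x\<bar> \<le> l ^ Suc m * R \<omega>"
proof -
  have "represents M (\<lambda>l \<omega>. vf_cb_op (\<xi> \<omega> l) ^ Suc m) (\<lambda>\<omega>. X \<omega> ^ Suc m)"
    using \<xi> by (intro represents_power) (simp add: admissible_def)
  moreover have "fps_nth (X \<omega> ^ Suc m) i = 0" if "i < Suc m" for \<omega> i
    using \<xi> that by (intro fps_power_nth_eq_0) (simp add: admissible_def)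
  ultimately obtain R where "R \<in> L_inf_minus M"
    "\<And>\<omega> l x. l \<in> {0..1} \<Longrightarrow> \<bar>app (vf_cb_op (\<xi> \<omega> l) ^ Suc m) f x\<bar> \<le> l ^ Suc m * R \<omega>"
    using represents_order_bound[OF _ _ f] by (metis (no_types, lifting))
  then show ?thesis
    using \<xi> f by (intro bexI[of _ R]) (auto simp: admissible_def intro!: vf_exp_taylor simp del: power_Suc)
qed

text \<open>For the case that the transported function is itself random.
  \<open>admissible_taylor\<close> gives a bound for one fixed function, so the claim is reduced to
  the fixed operators in the combination \<open>T\<close>, whose random coefficients multiply the
  bounds.\<close>

lemma admissible_taylor_rspan:
  assumes \<xi>: "admissible \<xi> X" and f: "f \<in> Cb_infinity" and T: "T \<in> rspan M UNIV"
  shows "\<exists>R\<in>L_inf_minus M. \<forall>\<omega>. \<forall>l\<in>{0..1}. \<forall>x.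
    \<bar>app (T \<omega>) f (vf_exp (\<xi> \<omega> l) x) - app (texp m (vf_cb_op (\<xi> \<omega> l)) * T \<omega>) f x\<bar> \<le> l ^ Suc m * R \<omega>"
  using T
proof induction
  case rspan_zero
  show ?case by (rule bexI[of _ "\<lambda>_. 0"]) (auto intro: L_inf_minus_const simp del: app_mult)
next
  case (rspan_base Z b)
  obtain R where R: "R \<in> L_inf_minus M" "\<And>\<omega> l x. l \<in> {0..1} \<Longrightarrow>
    \<bar>app b f (vf_exp (\<xi> \<omega> l) x) - app (texp m (vf_cb_op (\<xi> \<omega> l))) (app b f) x\<bar> \<le> l ^ Suc m * R \<omega>"
    using admissible_taylor[OF \<xi> app_Cb_infinity] by metis
  show ?case
  proof (intro bexI[of _ "\<lambda>\<omega>. \<bar>Z \<omega>\<bar> * R \<omega>"] allI ballI L_inf_minus_mult L_inf_minus_abs rspan_base R)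
    fix \<omega> l x assume "l \<in> {0..1::real}"
    then have "\<bar>Z \<omega>\<bar> * \<bar>app b f (vf_exp (\<xi> \<omega> l) x) - app (texp m (vf_cb_op (\<xi> \<omega> l)) * b) f x\<bar>
        \<le> \<bar>Z \<omega>\<bar> * (l ^ Suc m * R \<omega>)"
      using R(2) by (intro mult_left_mono) auto
    then show "\<bar>app (Z \<omega> *\<^sub>R b) f (vf_exp (\<xi> \<omega> l) x) - app (texp m (vf_cb_op (\<xi> \<omega> l)) * Z \<omega> *\<^sub>R b) f x\<bar>
        \<le> l ^ Suc m * (\<bar>Z \<omega>\<bar> * R \<omega>)"
      by (simp add: abs_mult[symmetric] right_diff_distrib mult_ac del: app_mult)
  qed
next
  case (rspan_add S T)
  then obtain R1 R2 where R: "R1 \<in> L_inf_minus M" "R2 \<in> L_inf_minus M"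
    "\<And>\<omega> l x. l \<in> {0..1} \<Longrightarrow>
      \<bar>app (S \<omega>) f (vf_exp (\<xi> \<omega> l) x) - app (texp m (vf_cb_op (\<xi> \<omega> l)) * S \<omega>) f x\<bar> \<le> l ^ Suc m * R1 \<omega>"
    "\<And>\<omega> l x. l \<in> {0..1} \<Longrightarrow>
      \<bar>app (T \<omega>) f (vf_exp (\<xi> \<omega> l) x) - app (texp m (vf_cb_op (\<xi> \<omega> l)) * T \<omega>) f x\<bar> \<le> l ^ Suc m * R2 \<omega>"
    by metis
  show ?case
  proof (intro bexI[of _ "\<lambda>\<omega>. R1 \<omega> + R2 \<omega>"] allI ballI L_inf_minus_add R)
    fix \<omega> l x assume "l \<in> {0..1::real}"
    from R(3,4)[OF this, of \<omega> x]
    show "\<bar>app (S \<omega> + T \<omega>) f (vf_exp (\<xi> \<omega> l) x) - app (texp m (vf_cb_op (\<xi> \<omega> l)) * (S \<omega> + T \<omega>)) f x\<bar>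
        \<le> l ^ Suc m * (R1 \<omega> + R2 \<omega>)"
      by (simp add: distrib_left del: app_mult power_Suc)
  qed
qed

lemma represents_prod_texp:
  assumes "list_all2 admissible \<xi>s Xs"
  shows "represents M (\<lambda>l \<omega>. prod_list (map (\<lambda>\<xi>. texp m (vf_cb_op (\<xi> \<omega> l))) \<xi>s))
    (\<lambda>\<omega>. prod_list (map (\<lambda>X. texp m (X \<omega>)) Xs))"
  using assms
  by (induction rule: list_all2_induct)
    (auto simp: admissible_def intro: represents_one represents_mult represents_texp)

text \<open>The tail is expanded first, by the induction hypothesis at the moved point
  exp(\<xi>)(x), which is allowed since the bound is uniform in x. The resulting function T f is
  then transported along the first flow, which puts the factor of the head on the left.\<close>

lemma chain_taylor:
  assumes "list_all2 admissible \<xi>s Xs" and f: "f \<in> Cb_infinity"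
  shows "\<exists>R\<in>L_inf_minus M. \<forall>\<omega>. \<forall>l\<in>{0..1}. \<forall>x. \<bar>f (fold (\<lambda>\<xi>. vf_exp (\<xi> \<omega> l)) \<xi>s x)
    - app (prod_list (map (\<lambda>\<xi>. texp m (vf_cb_op (\<xi> \<omega> l))) \<xi>s)) f x\<bar> \<le> l ^ Suc m * R \<omega>"
  using assms(1)
proof (induction rule: list_all2_induct)
  case Nil
  show ?case by (rule bexI[of _ "\<lambda>_. 0"]) (auto simp: app_one f intro: L_inf_minus_const)
next
  case (Cons \<xi> \<xi>s X Xs)
  define T where "T l \<omega> = prod_list (map (\<lambda>\<xi>. texp m (vf_cb_op (\<xi> \<omega> l))) \<xi>s)" for l \<omega>
  define Y where "Y \<omega> = prod_list (map (\<lambda>X. texp m (X \<omega>)) Xs)" for \<omega>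
  define E where "E l \<omega> = texp m (vf_cb_op (\<xi> \<omega> l))" for l \<omega>
  have T: "represents M T Y"
    unfolding T_def Y_def by (rule represents_prod_texp) (rule Cons)
  obtain N where N: "\<And>l \<omega> N'. N \<le> N' \<Longrightarrow> T l \<omega> = (\<Sum>i\<le>N'. l ^ i *\<^sub>R fps_nth (Y \<omega>) i)"
    using representsE[OF T] by metis
  note T_eq = N[OF order_refl]
  obtain R0 where R0: "R0 \<in> L_inf_minus M" "\<And>\<omega> l x. l \<in> {0..1} \<Longrightarrow>
      \<bar>f (fold (\<lambda>\<xi>. vf_exp (\<xi> \<omega> l)) \<xi>s x) - app (T l \<omega>) f x\<bar> \<le> l ^ Suc m * R0 \<omega>"
    using Cons.IH unfolding T_def by metis
  have "\<forall>i. \<exists>R\<in>L_inf_minus M. \<forall>\<omega>. \<forall>l\<in>{0..1}. \<forall>x.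
    \<bar>app (fps_nth (Y \<omega>) i) f (vf_exp (\<xi> \<omega> l) x) - app (E l \<omega> * fps_nth (Y \<omega>) i) f x\<bar> \<le> l ^ Suc m * R \<omega>"
    unfolding E_def using admissible_taylor_rspan[OF Cons.hyps(1) f represents_coeff[OF T]] by blast
  then obtain R where R: "\<And>i. R i \<in> L_inf_minus M" "\<And>i \<omega> l x. l \<in> {0..1} \<Longrightarrow>
    \<bar>app (fps_nth (Y \<omega>) i) f (vf_exp (\<xi> \<omega> l) x) - app (E l \<omega> * fps_nth (Y \<omega>) i) f x\<bar> \<le> l ^ Suc m * R i \<omega>"
    by metis
  \<comment> \<open>\<open>T\<close> depends on l as well, which
    \<open>admissible_taylor_rspan\<close> does not cover; it is applied to each coefficient of
    \<open>T\<close>, and the powers l^i are at most 1.\<close>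
  have step: "\<bar>app (T l \<omega>) f (vf_exp (\<xi> \<omega> l) x) - app (E l \<omega> * T l \<omega>) f x\<bar> \<le> l ^ Suc m * (\<Sum>i\<le>N. R i \<omega>)"
    if l: "l \<in> {0..1}" for l \<omega> x
  proof -
    let ?d = "\<lambda>i. app (fps_nth (Y \<omega>) i) f (vf_exp (\<xi> \<omega> l) x) - app (E l \<omega> * fps_nth (Y \<omega>) i) f x"
    have "app (T l \<omega>) f (vf_exp (\<xi> \<omega> l) x) - app (E l \<omega> * T l \<omega>) f x = (\<Sum>i\<le>N. l ^ i * ?d i)"
      unfolding T_eq sum_distrib_left mult_scaleR_right app_sum app_scaleR
      by (simp only: sum_subtractf right_diff_distrib)
    also have "\<bar>\<dots>\<bar> \<le> (\<Sum>i\<le>N. l ^ Suc m * R i \<omega>)"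
    proof (intro order_trans[OF sum_abs] sum_mono)
      fix i
      have "l ^ i \<le> 1" using l by (auto intro: power_le_one)
      then have "\<bar>l ^ i\<bar> * \<bar>?d i\<bar> \<le> 1 * (l ^ Suc m * R i \<omega>)"
        using R(2)[OF l] l by (intro mult_mono) auto
      then show "\<bar>l ^ i * ?d i\<bar> \<le> l ^ Suc m * R i \<omega>"
        by (simp only: abs_mult mult_1_left)
    qed
    finally show ?thesis by (simp only: sum_distrib_left)
  qed
  show ?case
  proof (intro bexI[of _ "\<lambda>\<omega>. R0 \<omega> + (\<Sum>i\<le>N. R i \<omega>)"] allI ballI L_inf_minus_add L_inf_minus_sum R0(1) R(1))
    fix \<omega> l x assume l: "l \<in> {0..1::real}"
    show "\<bar>f (fold (\<lambda>\<xi>. vf_exp (\<xi> \<omega> l)) (\<xi> # \<xi>s) x)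
      - app (prod_list (map (\<lambda>\<xi>. texp m (vf_cb_op (\<xi> \<omega> l))) (\<xi> # \<xi>s))) f x\<bar>
        \<le> l ^ Suc m * (R0 \<omega> + (\<Sum>i\<le>N. R i \<omega>))"
      using R0(2)[OF l, of \<omega> "vf_exp (\<xi> \<omega> l) x"] step[OF l, of \<omega> x]
      by (simp add: T_def[symmetric] E_def[symmetric] distrib_left del: app_mult power_Suc)
  qed
qed

lemma measurable_chain:
  assumes "list_all2 admissible \<xi>s Xs" "Y \<in> borel_measurable M"
  shows "(\<lambda>\<omega>. fold (\<lambda>\<xi>. vf_exp (\<xi> \<omega> l)) \<xi>s (Y \<omega>)) \<in> borel_measurable M"
  using assms
proof (induction arbitrary: Y rule: list_all2_induct)
  case (Cons \<xi> \<xi>s X Xs)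
  then have "(\<lambda>\<omega>. vf_exp (\<xi> \<omega> l) (Y \<omega>)) \<in> borel_measurable M"
    by (simp add: admissible_def)
  from Cons.IH[OF this] show ?case by simp
qed simp

text \<open>Three errors of size l^(m+1) with l = sqrt t add up: the two Taylor remainders, and the
  difference of the two polynomial operators, whose coefficients up to order m cancel. The constant
  is the expectation of the sum of the three random bounds, so it involves neither t nor x.\<close>

lemma chain_expectation_diff:
  assumes \<xi>: "list_all2 admissible \<xi>s Xs" and \<eta>: "list_all2 admissible \<eta>s Ys"
    and agree: "\<And>\<omega>. fps_agree m (prod_list (map (\<lambda>X. texp m (X \<omega>)) Xs)) (prod_list (map (\<lambda>X. texp m (X \<omega>)) Ys))"
    and f: "f \<in> Cb_infinity"
  shows "\<exists>C. \<forall>t\<in>{0<..1}. \<forall>x. \<bar>(\<integral>\<omega>. f (exp_chain t \<xi>s \<omega> x) \<partial>M) - (\<integral>\<omega>. f (exp_chain t \<eta>s \<omega> x) \<partial>M)\<bar>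
    \<le> C * t powr ((real m + 1) / 2)"
proof -
  define S where "S l \<omega> = prod_list (map (\<lambda>\<xi>. texp m (vf_cb_op (\<xi> \<omega> l))) \<xi>s)" for l \<omega>
  define T where "T l \<omega> = prod_list (map (\<lambda>\<xi>. texp m (vf_cb_op (\<xi> \<omega> l))) \<eta>s)" for l \<omega>
  define X where "X \<omega> = prod_list (map (\<lambda>X. texp m (X \<omega>)) Xs)" for \<omega>
  define Y where "Y \<omega> = prod_list (map (\<lambda>X. texp m (X \<omega>)) Ys)" for \<omega>
  have "represents M S X" "represents M T Y"
    unfolding S_def T_def X_def Y_def by (rule represents_prod_texp, fact)+
  then have rep: "represents M (\<lambda>l \<omega>. S l \<omega> + (-1) *\<^sub>R T l \<omega>) (\<lambda>\<omega>. X \<omega> + (-1) *\<^sub>R Y \<omega>)"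
    by (intro represents_add represents_scaleR)
  have "fps_nth (X \<omega> + (-1) *\<^sub>R Y \<omega>) i = 0" if "i < Suc m" for \<omega> i
    using agree[of \<omega>] that by (simp add: X_def Y_def fps_agree_def)
  from represents_order_bound[OF rep this f]
  obtain R3 where R3: "R3 \<in> L_inf_minus M" "\<And>\<omega> l x. l \<in> {0..1} \<Longrightarrow>
      \<bar>app (S l \<omega> + (-1) *\<^sub>R T l \<omega>) f x\<bar> \<le> l ^ Suc m * R3 \<omega>"
    by blast
  obtain R1 where R1: "R1 \<in> L_inf_minus M" "\<And>\<omega> l x. l \<in> {0..1} \<Longrightarrow>
      \<bar>f (fold (\<lambda>\<xi>. vf_exp (\<xi> \<omega> l)) \<xi>s x) - app (S l \<omega>) f x\<bar> \<le> l ^ Suc m * R1 \<omega>"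
    using chain_taylor[OF \<xi> f] unfolding S_def by metis
  obtain R2 where R2: "R2 \<in> L_inf_minus M" "\<And>\<omega> l x. l \<in> {0..1} \<Longrightarrow>
      \<bar>f (fold (\<lambda>\<xi>. vf_exp (\<xi> \<omega> l)) \<eta>s x) - app (T l \<omega>) f x\<bar> \<le> l ^ Suc m * R2 \<omega>"
    using chain_taylor[OF \<eta> f] unfolding T_def by metis
  define R where "R \<omega> = R1 \<omega> + R2 \<omega> + R3 \<omega>" for \<omega>
  have R: "integrable M R"
    unfolding R_def by (intro L_inf_minus_integrable L_inf_minus_add R1 R2 R3)
  obtain B where B: "\<And>x. norm (f x) \<le> B"
    using Cb_infinity_bounded[OF f] by (auto simp: bounded_range_iff)
  have "continuous_on UNIV f"
    by (intro continuous_at_imp_continuous_on ballI differentiable_imp_continuous_within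
        Cb_infinity_differentiable f)
  then have int: "integrable M (\<lambda>\<omega>. f (fold (\<lambda>\<xi>. vf_exp (\<xi> \<omega> l)) \<zeta>s x))"
    if "list_all2 admissible \<zeta>s Zs" for \<zeta>s Zs l x
    using borel_measurable_continuous_on[OF _ measurable_chain[OF that, of "\<lambda>_. x" l]]
    by (intro integrable_const_bound[where B = B]) (auto intro: B[unfolded real_norm_def])
  show ?thesis
  proof (intro exI[of _ "expectation R"] ballI allI)
    fix t :: real and x assume t: "t \<in> {0<..1}"
    define l where "l = sqrt t"
    have l: "l \<in> {0..1}" using t by (simp add: l_def)
    let ?F = "\<lambda>\<omega>. f (fold (\<lambda>\<xi>. vf_exp (\<xi> \<omega> l)) \<xi>s x)" and ?G = "\<lambda>\<omega>. f (fold (\<lambda>\<xi>. vf_exp (\<xi> \<omega> l)) \<eta>s x)"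
    have "\<bar>?F \<omega> - ?G \<omega>\<bar> \<le> l ^ Suc m * R \<omega>" for \<omega>
      using R1(2)[OF l, of \<omega> x] R2(2)[OF l, of \<omega> x] R3(2)[OF l, of \<omega> x]
      by (simp add: R_def distrib_left del: power_Suc)
    then have "\<bar>expectation (\<lambda>\<omega>. ?F \<omega> - ?G \<omega>)\<bar> \<le> expectation (\<lambda>\<omega>. l ^ Suc m * R \<omega>)"
      using R int[OF \<xi>, of l x] int[OF \<eta>, of l x]
      by (intro order_trans[OF integral_abs_bound] integral_mono) auto
    then have "\<bar>expectation ?F - expectation ?G\<bar> \<le> expectation R * l ^ Suc m"
      using int[OF \<xi>, of l x] int[OF \<eta>, of l x] by (simp add: mult.commute)
    moreover have "l ^ Suc m = t powr ((real m + 1) / 2)"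
      using t by (simp add: l_def powr_half_sqrt[symmetric] powr_realpow[symmetric] powr_powr add.commute del: power_Suc)
    ultimately show "\<bar>(\<integral>\<omega>. f (exp_chain t \<xi>s \<omega> x) \<partial>M) - (\<integral>\<omega>. f (exp_chain t \<eta>s \<omega> x) \<partial>M)\<bar>
        \<le> expectation R * t powr ((real m + 1) / 2)"
      by (simp add: exp_chain_def Psi_def l_def)
  qed
qed

end

section \<open>Assembly of the algebraic and the analytic part\<close>

context witt_algebra
begin

lemma lie_series_mono:
  assumes "A \<in> lie_series q r" "q \<le> q'"
  shows "A \<in> lie_series q' r"
proof -
  have "(\<lambda>\<omega>. fps_nth (A \<omega>) i) \<in> rspan M (w ` {r..q' * i})" for i
  proof (rule rspan_mono)
    show "(\<lambda>\<omega>. fps_nth (A \<omega>) i) \<in> rspan M (w ` {r..q * i})"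
      using assms(1) by (simp add: lie_series_def)
    show "w ` {r..q * i} \<subseteq> w ` {r..q' * i}"
      using mult_le_mono1[OF assms(2), of i] by (intro image_mono atLeastatMost_subset_iff[THEN iffD2]) simp
  qed
  then show ?thesis
    using assms(1) by (simp add: lie_series_def)
qed

text \<open>The polynomial has no constant term, so only orders i >= 1 occur, and for these k <= q
  gives k <= q * i.\<close>

lemma poly_series_lie:
  assumes Q: "Q \<in> Rpoly_star M" and "k \<le> q"
  shows "(\<lambda>\<omega>. poly_series (Q \<omega>) (w k)) \<in> lie_series q 0"
proof -
  note L = Rpoly_star_coeff_L[OF Q]
  have "(\<lambda>\<omega>. coeff (Q \<omega>) i *\<^sub>R w k) \<in> rspan M (w ` {0..q * i})" for i
  proof (cases i)
    case 0
    then show ?thesis using rspan_zero by (simp add: L(2))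
  next
    case (Suc j)
    then have "k \<le> q * i" using \<open>k \<le> q\<close> by (simp add: trans_le_add1)
    then show ?thesis by (intro rspan_base L(1)) auto
  qed
  then show ?thesis by (simp add: lie_series_def L(2))
qed

end

theorem theorem5:
  fixes M :: "'w measure"
    and V W :: "nat \<Rightarrow> real^'N::finite \<Rightarrow> real^'N"
    and d m :: nat
    and \<xi>s :: "('w, 'N) rvf_poly list"
  assumes "prob_space M"
    and "d \<ge> 1"
    and "\<forall>i\<le>d. V i \<in> Cb_infinity"
    and "witt_condition_via W d V"
    and "m \<ge> 1"
    and "\<xi>s \<noteq> []"
    and "set \<xi>s \<subseteq> L_star M W"
  shows "\<exists>k\<ge>1. \<exists>P. (\<forall>i\<le>k. P i \<in> Rpoly_star M) \<and>
    (\<forall>f\<in>Cb_infinity. \<exists>C. \<forall>t\<in>{0<..1}. \<forall>x.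
      \<bar>(\<integral>\<omega>. f (exp_chain t \<xi>s \<omega> x) \<partial>M)
        - (\<integral>\<omega>. f (exp_chain t (map (\<lambda>i. rvf_term (P i) (W i)) [0..<Suc k]) \<omega> x) \<partial>M)\<bar>
      \<le> C * t powr ((real m + 1) / 2))"
proof -
  interpret prob_space M by fact
  have W: "W n \<in> Cb_infinity" for n
    using assms(4) by (simp add: witt_condition_via_def)
  obtain \<alpha> where "\<And>n k. ad (vf_cb_op (W n)) (vf_cb_op (W k)) = \<alpha> n k *\<^sub>R vf_cb_op (W (n + k))"
    using witt_condition_ad[OF assms(4)] by metis
  then interpret witt_algebra M "\<lambda>n. vf_cb_op (W n)" \<alpha>
    by unfold_locales
  \<comment> \<open>\<open>q\<close> is a common bound on the indices of the \<open>W k\<close>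
    occurring in the finitely many \<xi>; it bounds the growth of indices with the order.\<close>
  have "\<exists>q Xs. list_all2 admissible \<xi>s Xs \<and> set Xs \<subseteq> lie_series q 0"
    using assms(7)
  proof (induction \<xi>s)
    case (Cons \<xi> \<xi>s)
    then obtain q Xs where Xs: "list_all2 admissible \<xi>s Xs" "set Xs \<subseteq> lie_series q 0"
      by auto
    obtain n Q where Q: "\<forall>k\<le>n. Q k \<in> Rpoly_star M"
      and \<xi>: "\<xi> = (\<lambda>\<omega> l x. \<Sum>k\<le>n. rvf_term (Q k) (W k) \<omega> l x)"
      using Cons.prems by (auto simp: L_star_def)
    define X where "X \<omega> = (\<Sum>k\<le>n. poly_series (Q k \<omega>) (vf_cb_op (W k)))" for \<omega>
    have "admissible \<xi> X"
      unfolding \<xi> X_def using Q by (intro admissible_sum W) auto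
    moreover have "X \<in> lie_series n 0"
      unfolding X_def using Q by (intro lie_series_sum poly_series_lie) auto
    ultimately show ?case
      using Xs by (intro exI[of _ "max n q"] exI[of _ "X # Xs"]) (auto intro: lie_series_mono)
  qed (auto intro: exI[of _ "[]"])
  then obtain q Xs where Xs: "list_all2 admissible \<xi>s Xs" "set Xs \<subseteq> lie_series q 0"
    by blast
  \<comment> \<open>Up to order m no index above \<open>m * q\<close> is visible; the maximum with 1
    ensures k >= 1 also when q = 0.\<close>
  define k where "k = max 1 (m * q)"
  obtain P where P: "\<And>n. P n \<in> Rpoly_star M"
    and agree: "\<And>\<omega>. fps_agree m (prod_list (map (\<lambda>X. texp m (X \<omega>)) Xs))
      (prod_list (map (\<lambda>n. texp m (poly_series (P n \<omega>) (vf_cb_op (W n)))) [0..<Suc k]))"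
    using prod_texp_ordered[OF Xs(2) \<open>m \<ge> 1\<close>, of k] by (auto simp: k_def)
  let ?\<eta>s = "map (\<lambda>i. rvf_term (P i) (W i)) [0..<Suc k]"
  let ?Ys = "map (\<lambda>i \<omega>. poly_series (P i \<omega>) (vf_cb_op (W i))) [0..<Suc k]"
  \<comment> \<open>A single term is a sum with n = 0, taken over constant families.\<close>
  have "admissible (rvf_term (P i) (W i)) (\<lambda>\<omega>. poly_series (P i \<omega>) (vf_cb_op (W i)))" for i
    using admissible_sum[of 0 "\<lambda>_. P i" "\<lambda>_. W i"] P W by simp
  then have "list_all2 admissible ?\<eta>s ?Ys"
    by (simp add: list_all2_map1 list_all2_map2 list_all2_same del: upt_Suc)
  moreover have "fps_agree m (prod_list (map (\<lambda>X. texp m (X \<omega>)) Xs)) (prod_list (map (\<lambda>X. texp m (X \<omega>)) ?Ys))" for \<omega>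
    using agree[of \<omega>] by (simp add: o_def del: upt_Suc)
  ultimately have "\<forall>f\<in>Cb_infinity. \<exists>C. \<forall>t\<in>{0<..1}. \<forall>x.
      \<bar>(\<integral>\<omega>. f (exp_chain t \<xi>s \<omega> x) \<partial>M) - (\<integral>\<omega>. f (exp_chain t ?\<eta>s \<omega> x) \<partial>M)\<bar>
      \<le> C * t powr ((real m + 1) / 2)"
    using chain_expectation_diff[OF Xs(1)] by blast
  then show ?thesis
    using P by (intro exI[of _ k] conjI exI[of _ P]) (auto simp: k_def)
qed

end
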